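(* Let $G$ be a triangle-free graph of order $n$. Then $\phi'(G)\le 6^{n/4}$. Furthermore, $\phi'(G)=6^{n/4}$ if and only if $n\equiv 0\pmod 4$ and $G$ is isomorphic to the disjoint union of $n/4$ copies of $C_4$.
   Context: All graphs are finite, simple, undirected and labeled. A subset $F$ of vertices of a graph $G$ is a dissociation set if the induced subgraph $G[F]$ has maximum degree at most $1$. A maximum dissociation set is a dissociation set of maximum cardinality. $\phi'(G)$ denotes the number of maximum dissociation sets of $G$. *)

theory Defs
  imports Complex_Main
begin

definition simple_graph :: "'a set \<Rightarrow> ('a \<Rightarrow> 'a \<Rightarrow> bool) \<Rightarrow> bool" where
  "simple_graph V E \<longleftrightarrow> finite V \<and> (\<forall>x y. E x y \<longrightarrow> x \<in> V \<and> y \<in> V)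
     \<and> (\<forall>x y. E x y \<longrightarrow> E y x) \<and> (\<forall>x. \<not> E x x)"

definition triangle_free :: "'a set \<Rightarrow> ('a \<Rightarrow> 'a \<Rightarrow> bool) \<Rightarrow> bool" where
  "triangle_free V E \<longleftrightarrow> \<not> (\<exists>x\<in>V. \<exists>y\<in>V. \<exists>z\<in>V. E x y \<and> E y z \<and> E x z)"

definition dissociation_set :: "'a set \<Rightarrow> ('a \<Rightarrow> 'a \<Rightarrow> bool) \<Rightarrow> 'a set \<Rightarrow> bool" where
  "dissociation_set V E F \<longleftrightarrow> F \<subseteq> V \<and> (\<forall>v\<in>F. card {u\<in>F. E v u} \<le> 1)"

definition max_dissociation_set :: "'a set \<Rightarrow> ('a \<Rightarrow> 'a \<Rightarrow> bool) \<Rightarrow> 'a set \<Rightarrow> bool" where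
  "max_dissociation_set V E F \<longleftrightarrow> dissociation_set V E F \<and>
     (\<forall>F'. dissociation_set V E F' \<longrightarrow> card F' \<le> card F)"

definition num_max_dissociation :: "'a set \<Rightarrow> ('a \<Rightarrow> 'a \<Rightarrow> bool) \<Rightarrow> nat" where
  "num_max_dissociation V E = card {F. max_dissociation_set V E F}"

definition graph_iso :: "'a set \<Rightarrow> ('a \<Rightarrow> 'a \<Rightarrow> bool) \<Rightarrow> 'b set \<Rightarrow> ('b \<Rightarrow> 'b \<Rightarrow> bool) \<Rightarrow> bool" where
  "graph_iso V E W F \<longleftrightarrow> (\<exists>f. bij_betw f V W \<and> (\<forall>x\<in>V. \<forall>y\<in>V. E x y \<longleftrightarrow> F (f x) (f y)))"

definition kC4_verts :: "nat \<Rightarrow> (nat \<times> nat) set" where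
  "kC4_verts k = {0..<k} \<times> {0..<4}"

definition kC4_edge :: "nat \<Rightarrow> nat \<times> nat \<Rightarrow> nat \<times> nat \<Rightarrow> bool" where
  "kC4_edge k p q \<longleftrightarrow> p \<in> kC4_verts k \<and> q \<in> kC4_verts k \<and> fst p = fst q \<and>
     (snd q = (snd p + 1) mod 4 \<or> snd p = (snd q + 1) mod 4)"

end

theory Submission
  imports Defs
begin

text \<open>
  Let $r = 6^{-1/4}$ and normalise the number of maximum dissociation sets of the subgraph induced
  by $W$ to $\nu(W) = r^{|W|} \phi'(W)$; the claim is $\nu \le 1$. Strong induction over vertex sets
  uses one branching inequality: if $N[T] \subseteq S$, the maximum dissociation sets meeting $S$ exactly in
  $T$ inject into those of $W - S$. Distinguishing whether a vertex $v$ is absent, isolated or paired,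
  and using that $N(u)$ and $N(v)$ are disjoint for an edge $uv$,
  $$\nu(W) \le r\,\nu(W - v) + r^{d(v)+1}\,\nu(W - N[v]) + \sum_{u \in N(v)} r^{d(u)+d(v)}\,\nu(W - N(u) - N(v)).$$
  A vertex of degree at most 1 forces $\nu \le r^2+r^3+r^4 < 0.8358$. This gain, applied to the graphs left
  after a deletion, makes the right hand side strictly smaller than 1 at a vertex of degree at least 4 and at
  a vertex of degree 3 with a neighbour of degree 2, then around a vertex whose surroundings
  are cubic, and finally in a 2-regular graph without 4-cycles. The only case left is a component $C_4$,
  which contributes exactly the factor $6 = r^{-4}$.
\<close>

text \<open>At most one neighbour in \<open>F\<close> means that any two neighbours in
  \<open>F\<close> coincide; this first-order form replaces cardinalities in the later arguments
  about individual edges.\<close>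

lemma dissociation_set_iff:
  assumes "finite W"
  shows "dissociation_set W E F \<longleftrightarrow>
    F \<subseteq> W \<and> (\<forall>v\<in>F. \<forall>x\<in>F. \<forall>y\<in>F. E v x \<longrightarrow> E v y \<longrightarrow> x = y)"
proof -
  have "card {u\<in>F. E v u} \<le> 1 \<longleftrightarrow> (\<forall>x\<in>F. \<forall>y\<in>F. E v x \<longrightarrow> E v y \<longrightarrow> x = y)"
    if "F \<subseteq> W" for v
  proof -
    have "finite {u\<in>F. E v u}" using that assms by (auto intro: finite_subset)
    then show ?thesis by (subst One_nat_def, subst card_le_Suc0_iff_eq) auto
  qed
  then show ?thesis unfolding dissociation_set_def by auto
qed

section \<open>Numerical bounds for powers of 6^(-1/4)\<close>

definition decay :: real where "decay = 1 / root 4 6"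

lemma decay_pos: "decay > 0" by (simp add: decay_def)

lemma decay4: "decay ^ 4 = 1 / 6"
  by (simp add: decay_def power_one_over)

text \<open>The true values of \<open>decay\<close>, \<open>decay ^ 2\<close>,
  \<open>decay ^ 3\<close> are about 0.638943, 0.408248, 0.260847. Their rounded-up bounds, together
  with \<open>decay ^ 4 = 1 / 6\<close>, turn the closing comparison of each case into linear
  arithmetic.\<close>

lemma decay2_le: "decay ^ 2 \<le> 40825 / 100000"
proof (rule power2_le_imp_le)
  have "(decay ^ 2)\<^sup>2 = decay ^ 4" by simp
  then show "(decay ^ 2)\<^sup>2 \<le> (40825 / 100000 :: real)\<^sup>2" by (simp add: decay4 power2_eq_square)
qed simp

lemma decay_le: "decay \<le> 63895 / 100000"
proof (rule power2_le_imp_le)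
  have "(40825 / 100000 :: real) \<le> (63895 / 100000)\<^sup>2" by (simp add: power2_eq_square)
  then show "decay\<^sup>2 \<le> (63895 / 100000 :: real)\<^sup>2" using decay2_le by linarith
qed simp

lemma decay3_le: "decay ^ 3 \<le> 260852 / 1000000"
proof -
  have "decay ^ 3 = decay * decay ^ 2" by (simp add: eval_nat_numeral)
  also have "\<dots> \<le> (63895 / 100000) * (40825 / 100000)"
    by (intro mult_mono decay_le decay2_le) (auto simp: decay_pos less_imp_le)
  finally show ?thesis by simp
qed

lemma decay5: "decay ^ 5 = decay / 6"
proof -
  have "decay ^ 5 = decay * decay ^ 4" by (simp add: eval_nat_numeral)
  then show ?thesis by (simp add: decay4)
qed

lemma decay6: "decay ^ 6 = decay ^ 2 / 6"
proof -
  have "decay ^ 6 = decay ^ 2 * decay ^ 4" by (simp add: eval_nat_numeral)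
  then show ?thesis by (simp add: decay4)
qed

lemma decay_power_antimono: "m \<le> n \<Longrightarrow> decay ^ n \<le> decay ^ m"
  using decay_pos decay_le by (intro power_decreasing) auto

text \<open>From \<open>n\<close> to \<open>n + 1\<close> the term is multiplied by
  \<open>decay * (n + 1) / n\<close>, which is below 1 once \<open>n\<close> is at least 2 but
  exceeds 1 for \<open>n = 1\<close>.\<close>

lemma mult_decay_power_antimono:
  assumes "2 \<le> m" "m \<le> n"
  shows "real n * decay ^ n \<le> real m * decay ^ m"
  using assms(2)
proof (induction n rule: dec_induct)
  case (step n)
  have "real (Suc n) * decay \<le> real (Suc n) * (63895 / 100000)"
    using decay_le by (intro mult_left_mono) auto
  also have "\<dots> \<le> real n" using step assms(1) by simp
  finally have "real (Suc n) * decay * decay ^ n \<le> real n * decay ^ n"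
    using decay_pos by (intro mult_right_mono) auto
  then show ?case using step.IH by simp
qed simp

text \<open>From 2 onwards the sequence falls. Only \<open>n = 1\<close> is left, where the claim
  amounts to \<open>decay\<close> being at least 1/2, and this holds because 1/6 > 1/16.\<close>

lemma mult_decay_power_le:
  assumes "1 \<le> n"
  shows "real n * decay ^ n \<le> 2 * decay ^ 2"
proof (cases "n = 1")
  case True
  have "decay * 1 \<le> decay * (2 * decay)"
  proof (rule mult_left_mono)
    show "1 \<le> 2 * decay"
    proof (rule ccontr)
      assume "\<not> 1 \<le> 2 * decay"
      then have "decay ^ 4 < (1 / 2) ^ 4"
        using decay_pos by (intro power_strict_mono) auto
      then show False by (simp add: decay4 power_one_over)
    qed
  qed (simp add: decay_pos less_imp_le)
  then show ?thesis using True by (simp add: power2_eq_square)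
next
  case False
  then show ?thesis using mult_decay_power_antimono[of 2 n] assms by simp
qed

section \<open>The target graph: disjoint copies of C4\<close>

lemma kC4_verts_Suc: "kC4_verts (Suc k) = {(k, 0), (k, 1), (k, 2), (k, 3)} \<union> kC4_verts k"
proof -
  have "{0..<4::nat} = {0, 1, 2, 3}" by auto
  then have "kC4_verts j = {0..<j} \<times> {0, 1, 2, 3}" for j by (simp only: kC4_verts_def)
  then show ?thesis by (auto simp: less_Suc_eq)
qed

lemma fst_kC4_verts: "p \<in> kC4_verts k \<Longrightarrow> fst p < k"
  by (auto simp: kC4_verts_def)

text \<open>Written out for the copy with index \<open>k\<close>, so that 4-cycles can be attached
  or removed one at a time.\<close>

lemma kC4_edge_top:
  "kC4_edge (Suc k) (k, 0) q \<longleftrightarrow> q = (k, Suc 0) \<or> q = (k, 3)"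
  "kC4_edge (Suc k) (k, Suc 0) q \<longleftrightarrow> q = (k, 0) \<or> q = (k, 2)"
  "kC4_edge (Suc k) (k, 2) q \<longleftrightarrow> q = (k, Suc 0) \<or> q = (k, 3)"
  "kC4_edge (Suc k) (k, 3) q \<longleftrightarrow> q = (k, 0) \<or> q = (k, 2)"
proof -
  obtain i j where q: "q = (i, j)" by (cases q)
  have "j \<in> {0, Suc 0, 2, 3} \<or> 4 \<le> j" by auto
  then show
    "kC4_edge (Suc k) (k, 0) q \<longleftrightarrow> q = (k, Suc 0) \<or> q = (k, 3)"
    "kC4_edge (Suc k) (k, Suc 0) q \<longleftrightarrow> q = (k, 0) \<or> q = (k, 2)"
    "kC4_edge (Suc k) (k, 2) q \<longleftrightarrow> q = (k, Suc 0) \<or> q = (k, 3)"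
    "kC4_edge (Suc k) (k, 3) q \<longleftrightarrow> q = (k, 0) \<or> q = (k, 2)"
    unfolding q by (elim disjE insertE emptyE; force simp: kC4_edge_def kC4_verts_def)+
qed

lemma kC4_edge_sym: "kC4_edge k p q \<longleftrightarrow> kC4_edge k q p"
  unfolding kC4_edge_def by metis

lemma kC4_edge_Suc:
  "p \<in> kC4_verts k \<Longrightarrow> q \<in> kC4_verts k \<Longrightarrow> kC4_edge (Suc k) p q \<longleftrightarrow> kC4_edge k p q"
  by (simp add: kC4_edge_def kC4_verts_Suc)

section \<open>Weighted counting and the branching inequality\<close>

locale triangle_free_graph =
  fixes E :: "'a \<Rightarrow> 'a \<Rightarrow> bool"
  assumes sym: "E x y \<Longrightarrow> E y x"
    and irrefl: "\<not> E x x"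
    and no_triangle: "E x y \<Longrightarrow> E y z \<Longrightarrow> \<not> E x z"
begin

text \<open>The edge relation stays fixed and \<open>W\<close> stands for the subgraph it induces,
  so deleting vertices is set difference and the induction runs over finite sets.\<close>

definition nbhd :: "'a set \<Rightarrow> 'a \<Rightarrow> 'a set" where
  "nbhd W v = {u\<in>W. E v u}"

text \<open>The predicate \<open>Q\<close> selects among the maximum dissociation sets of
  \<open>W\<close>, so the cases of a branching can be added up while maximality still refers to
  \<open>W\<close>. A C4 has 6 maximum sets and hence weight 1.\<close>

definition weight :: "'a set \<Rightarrow> ('a set \<Rightarrow> bool) \<Rightarrow> real" where
  "weight W Q = decay ^ card W * real (card {F. max_dissociation_set W E F \<and> Q F})"

abbreviation total :: "'a set \<Rightarrow> real" where
  "total W \<equiv> weight W (\<lambda>_. True)"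

lemma finite_max_dissociation_sets:
  "finite W \<Longrightarrow> finite {F. max_dissociation_set W E F \<and> Q F}"
  by (rule finite_subset[of _ "Pow W"])
    (auto simp: max_dissociation_set_def dissociation_set_def)

lemma weight_nonneg: "0 \<le> weight W Q"
  using decay_pos by (simp add: weight_def)

lemma weight_mono:
  assumes "finite W" "\<And>F. max_dissociation_set W E F \<Longrightarrow> P F \<Longrightarrow> Q F"
  shows "weight W P \<le> weight W Q"
  unfolding weight_def using assms decay_pos
  by (intro mult_left_mono) (auto intro!: card_mono finite_max_dissociation_sets)

lemma weight_le_disj:
  assumes "finite W" "\<And>F. max_dissociation_set W E F \<Longrightarrow> P F \<Longrightarrow> Q F \<or> R F"
  shows "weight W P \<le> weight W Q + weight W R"
proof -
  have "card {F. max_dissociation_set W E F \<and> P F}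
      \<le> card ({F. max_dissociation_set W E F \<and> Q F} \<union> {F. max_dissociation_set W E F \<and> R F})"
    using assms by (intro card_mono) (auto intro: finite_max_dissociation_sets)
  also have "\<dots> \<le> card {F. max_dissociation_set W E F \<and> Q F} + card {F. max_dissociation_set W E F \<and> R F}"
    by (rule card_Un_le)
  finally show ?thesis unfolding weight_def distrib_left[symmetric] of_nat_add[symmetric]
    using decay_pos by (intro mult_left_mono) auto
qed

lemma weight_le_sum:
  assumes "finite W" "finite A" "\<And>F. max_dissociation_set W E F \<Longrightarrow> P F \<Longrightarrow> \<exists>u\<in>A. Q u F"
  shows "weight W P \<le> (\<Sum>u\<in>A. weight W (Q u))"
proof -
  have "card {F. max_dissociation_set W E F \<and> P F}
      \<le> card (\<Union>u\<in>A. {F. max_dissociation_set W E F \<and> Q u F})"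
    using assms by (intro card_mono) (auto intro: finite_max_dissociation_sets)
  also have "\<dots> \<le> (\<Sum>u\<in>A. card {F. max_dissociation_set W E F \<and> Q u F})"
    using assms(2) by (rule card_UN_le)
  finally have "real (card {F. max_dissociation_set W E F \<and> P F})
      \<le> (\<Sum>u\<in>A. real (card {F. max_dissociation_set W E F \<and> Q u F}))"
    by (metis of_nat_sum of_nat_le_iff)
  then show ?thesis unfolding weight_def sum_distrib_left[symmetric]
    using decay_pos by (intro mult_left_mono) auto
qed

text \<open>\<open>F\<close> is recovered from \<open>F - S\<close> because
  \<open>F \<inter> S\<close> is fixed. The remainder is maximum in \<open>W - S\<close>: all
  neighbours of \<open>T\<close> lie in \<open>S\<close>, so any dissociation set of
  \<open>W - S\<close> can be united with \<open>T\<close>, and a larger one would beat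
  \<open>F\<close>.\<close>

lemma weight_branch:
  assumes "finite W" "S \<subseteq> W" "T \<subseteq> S" "\<And>t. t \<in> T \<Longrightarrow> nbhd W t \<subseteq> S"
  shows "weight W (\<lambda>F. F \<inter> S = T \<and> Q (F - S)) \<le> decay ^ card S * weight (W - S) Q"
proof -
  let ?A = "{F. max_dissociation_set W E F \<and> F \<inter> S = T \<and> Q (F - S)}"
  let ?B = "{F. max_dissociation_set (W - S) E F \<and> Q F}"
  have fin: "finite (W - S)" using assms(1) by simp
  have "card ?A \<le> card ?B"
  proof (rule card_inj_on_le)
    show "inj_on (\<lambda>F. F - S) ?A" by (rule inj_onI) blast
    show "(\<lambda>F. F - S) ` ?A \<subseteq> ?B"
    proof
      fix F' assume "F' \<in> (\<lambda>F. F - S) ` ?A"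
      then obtain F where F': "F' = F - S"
        and F: "max_dissociation_set W E F" "T = F \<inter> S" "Q (F - S)" by blast
      have FW: "F \<subseteq> W" and Fd: "\<And>v x y. \<lbrakk>v \<in> F; x \<in> F; y \<in> F; E v x; E v y\<rbrakk> \<Longrightarrow> x = y"
        and Fmax: "\<And>F'. dissociation_set W E F' \<Longrightarrow> card F' \<le> card F"
        using F(1) assms(1) unfolding max_dissociation_set_def dissociation_set_iff[OF assms(1)] by blast+
      have "card F' \<le> card (F - S)" if "dissociation_set (W - S) E F'" for F'
      proof -
        have F'W: "F' \<subseteq> W - S" and F'd: "\<And>v x y. \<lbrakk>v \<in> F'; x \<in> F'; y \<in> F'; E v x; E v y\<rbrakk> \<Longrightarrow> x = y"
          using that unfolding dissociation_set_iff[OF fin] by blast+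
        have cross: "\<not> E t x" "\<not> E x t" if "t \<in> T" "x \<in> F'" for t x
          using that assms(4)[OF that(1)] F'W sym unfolding nbhd_def by blast+
        have "dissociation_set W E (F' \<union> T)"
          unfolding dissociation_set_iff[OF assms(1)]
        proof (intro conjI ballI impI)
          show "F' \<union> T \<subseteq> W" using F'W F(2) FW by blast
        next
          fix v x y assume "v \<in> F' \<union> T" "x \<in> F' \<union> T" "y \<in> F' \<union> T" "E v x" "E v y"
          then show "x = y" using cross F'd Fd F(2) by blast
        qed
        then have "card (F' \<union> T) \<le> card F" by (rule Fmax)
        moreover have "card (F' \<union> T) = card F' + card T"
          using F'W F(2) FW assms(1)
          by (intro card_Un_disjoint) (auto intro: finite_subset)
        moreover have "card F = card (F - S) + card T"
          using F(2) FW assms(1)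
          by (subst card_Un_disjoint[symmetric])
            (auto intro: finite_subset intro!: arg_cong[where f = card])
        ultimately show ?thesis by simp
      qed
      moreover have "dissociation_set (W - S) E (F - S)"
        unfolding dissociation_set_iff[OF fin] using FW Fd by blast
      ultimately show "F' \<in> ?B"
        using F(3) F' unfolding max_dissociation_set_def by blast
    qed
    show "finite ?B" using fin by (rule finite_max_dissociation_sets)
  qed
  moreover have "card W = card S + card (W - S)"
    using assms(1,2) by (metis card_mono card_Diff_subset finite_subset le_add_diff_inverse)
  ultimately show ?thesis
    using decay_pos by (simp add: weight_def power_add mult_left_mono)
qed

text \<open>The last two hypotheses say that \<open>u\<close> would get at most one partner in
  \<open>F\<close>, itself unpaired so far. Then \<open>insert u F\<close> is a larger dissociation
  set.\<close>

lemma max_dissociation_extend: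
  assumes "finite W" "max_dissociation_set W E F" "u \<in> W" "u \<notin> F"
    "\<And>x y. \<lbrakk>x \<in> F; y \<in> F; E u x; E u y\<rbrakk> \<Longrightarrow> x = y"
    "\<And>x y. \<lbrakk>x \<in> F; y \<in> F; E u x\<rbrakk> \<Longrightarrow> \<not> E x y"
  shows False
proof -
  have FW: "F \<subseteq> W" and Fd: "\<And>v x y. \<lbrakk>v \<in> F; x \<in> F; y \<in> F; E v x; E v y\<rbrakk> \<Longrightarrow> x = y"
    and Fmax: "\<And>F'. dissociation_set W E F' \<Longrightarrow> card F' \<le> card F"
    using assms(2) unfolding max_dissociation_set_def dissociation_set_iff[OF assms(1)] by blast+
  have "dissociation_set W E (insert u F)"
    unfolding dissociation_set_iff[OF assms(1)]
  proof (intro conjI ballI impI)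
    show "insert u F \<subseteq> W" using FW assms(3) by blast
  next
    fix v x y assume "v \<in> insert u F" "x \<in> insert u F" "y \<in> insert u F" "E v x" "E v y"
    then show "x = y" using assms(5,6) Fd sym irrefl by blast
  qed
  then have "card (insert u F) \<le> card F" by (rule Fmax)
  moreover have "finite F" using FW assms(1) by (rule finite_subset)
  ultimately show False using assms(4) by simp
qed

lemma finite_nbhd: "finite W \<Longrightarrow> finite (nbhd W v)"
  by (simp add: nbhd_def)

lemma self_notin_nbhd: "v \<notin> nbhd W v"
  using irrefl by (simp add: nbhd_def)

text \<open>Triangle-freeness makes the neighbourhoods of adjacent vertices disjoint; this gives the
  paired branch its exponent d(u) + d(v).\<close>

lemma card_nbhd_Un:
  assumes "finite W" "u \<in> nbhd W v"
  shows "card (nbhd W v \<union> nbhd W u) = card (nbhd W v) + card (nbhd W u)"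
  using assms no_triangle by (intro card_Un_disjoint finite_nbhd) (auto simp: nbhd_def)

lemma weight_out:
  assumes "finite W" "v \<in> W"
  shows "weight W (\<lambda>F. v \<notin> F) \<le> decay * total (W - {v})"
proof -
  have "weight W (\<lambda>F. v \<notin> F) \<le> weight W (\<lambda>F. F \<inter> {v} = {} \<and> True)"
    using assms by (intro weight_mono) auto
  also have "\<dots> \<le> decay ^ card {v} * total (W - {v})"
    using assms by (intro weight_branch) auto
  finally show ?thesis by simp
qed

text \<open>The predicate \<open>Q\<close> carries along the information that some vertex is forced
  into \<open>F\<close>; the gain is then drawn from \<open>weight_member_le\<close> in the
  remaining graph.\<close>

lemma weight_isolated:
  assumes "finite W" "v \<in> W"
  shows "weight W (\<lambda>F. v \<in> F \<and> F \<inter> nbhd W v = {} \<and> Q (F - insert v (nbhd W v)))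
    \<le> decay ^ (card (nbhd W v) + 1) * weight (W - insert v (nbhd W v)) Q"
proof -
  have "weight W (\<lambda>F. v \<in> F \<and> F \<inter> nbhd W v = {} \<and> Q (F - insert v (nbhd W v)))
      \<le> weight W (\<lambda>F. F \<inter> insert v (nbhd W v) = {v} \<and> Q (F - insert v (nbhd W v)))"
    using assms by (intro weight_mono) auto
  also have "\<dots> \<le> decay ^ card (insert v (nbhd W v)) * weight (W - insert v (nbhd W v)) Q"
    using assms by (intro weight_branch) (auto simp: nbhd_def)
  finally show ?thesis using assms self_notin_nbhd by (simp add: finite_nbhd)
qed

lemma weight_pair:
  assumes "finite W" "v \<in> W" "u \<in> nbhd W v"
  shows "weight W (\<lambda>F. v \<in> F \<and> u \<in> F)
    \<le> decay ^ (card (nbhd W v) + card (nbhd W u)) * total (W - (nbhd W v \<union> nbhd W u))"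
proof -
  let ?S = "nbhd W v \<union> nbhd W u"
  \<comment> \<open>\<open>u\<close> and \<open>v\<close> are each other's only neighbours in
    \<open>F\<close>, so \<open>F\<close> contains nothing else of \<open>?S\<close>, and
    \<open>?S\<close> includes both of them since they are adjacent.\<close>
  have "weight W (\<lambda>F. v \<in> F \<and> u \<in> F) \<le> weight W (\<lambda>F. F \<inter> ?S = {v, u} \<and> True)"
  proof (rule weight_mono)
    fix F assume F: "max_dissociation_set W E F" "v \<in> F \<and> u \<in> F"
    then have "\<And>v x y. \<lbrakk>v \<in> F; x \<in> F; y \<in> F; E v x; E v y\<rbrakk> \<Longrightarrow> x = y"
      unfolding max_dissociation_set_def dissociation_set_iff[OF assms(1)] by blast
    then show "F \<inter> ?S = {v, u} \<and> True" using F(2) assms sym unfolding nbhd_def by blast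
  qed fact
  also have "\<dots> \<le> decay ^ card ?S * total (W - ?S)"
    using assms sym by (intro weight_branch) (auto simp: nbhd_def)
  finally show ?thesis using assms by (simp add: card_nbhd_Un)
qed

lemma weight_paired:
  assumes "finite W" "v \<in> W"
  shows "weight W (\<lambda>F. v \<in> F \<and> F \<inter> nbhd W v \<noteq> {})
    \<le> (\<Sum>u\<in>nbhd W v. decay ^ (card (nbhd W v) + card (nbhd W u)) * total (W - (nbhd W v \<union> nbhd W u)))"
proof -
  have "weight W (\<lambda>F. v \<in> F \<and> F \<inter> nbhd W v \<noteq> {}) \<le> (\<Sum>u\<in>nbhd W v. weight W (\<lambda>F. v \<in> F \<and> u \<in> F))"
    using assms by (intro weight_le_sum) (auto simp: finite_nbhd)
  also have "\<dots> \<le> (\<Sum>u\<in>nbhd W v. decay ^ (card (nbhd W v) + card (nbhd W u)) * total (W - (nbhd W v \<union> nbhd W u)))"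
    using assms by (intro sum_mono weight_pair)
  finally show ?thesis .
qed

subsection \<open>Low degree vertices\<close>

lemma nbhd_Diff: "nbhd (W - S) v = nbhd W v - S"
  by (auto simp: nbhd_def)

lemma nbhd_subset: "nbhd W v \<subseteq> W"
  by (auto simp: nbhd_def)

lemma nbhd_sym: "v \<in> W \<Longrightarrow> u \<in> nbhd W v \<Longrightarrow> v \<in> nbhd W u"
  using sym by (simp add: nbhd_def)

lemma card_nbhd_pos: "finite W \<Longrightarrow> v \<in> W \<Longrightarrow> u \<in> nbhd W v \<Longrightarrow> 1 \<le> card (nbhd W u)"
  using nbhd_sym by (metis One_nat_def Suc_leI card_gt_0_iff empty_iff finite_nbhd)

lemma decay_mult_total_le:
  "total X \<le> 1 \<Longrightarrow> decay ^ m * total X \<le> decay ^ m"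
  using decay_pos by (intro mult_left_le) auto

text \<open>Each remaining graph omits \<open>v\<close>, which lies in \<open>nbhd W u\<close>, so
  the induction hypothesis bounds its total by 1 and only powers of \<open>decay\<close> are
  left.\<close>

lemma weight_paired_le:
  assumes "finite W" "v \<in> W" and IH: "\<And>X. X \<subset> W \<Longrightarrow> total X \<le> 1"
  shows "weight W (\<lambda>F. v \<in> F \<and> F \<inter> nbhd W v \<noteq> {})
    \<le> (\<Sum>u\<in>nbhd W v. decay ^ (card (nbhd W v) + card (nbhd W u)))"
proof -
  have "weight W (\<lambda>F. v \<in> F \<and> F \<inter> nbhd W v \<noteq> {})
    \<le> (\<Sum>u\<in>nbhd W v. decay ^ (card (nbhd W v) + card (nbhd W u)) * total (W - (nbhd W v \<union> nbhd W u)))"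
    using assms by (intro weight_paired)
  also have "\<dots> \<le> (\<Sum>u\<in>nbhd W v. decay ^ (card (nbhd W v) + card (nbhd W u)))"
    using nbhd_sym[OF assms(2)] assms(2) by (intro sum_mono decay_mult_total_le IH) blast
  finally show ?thesis .
qed

lemma weight_isolated_le:
  assumes "finite W" "v \<in> W" and IH: "\<And>X. X \<subset> W \<Longrightarrow> total X \<le> 1"
  shows "weight W (\<lambda>F. v \<in> F \<and> F \<inter> nbhd W v = {}) \<le> decay ^ (card (nbhd W v) + 1)"
proof -
  have "weight W (\<lambda>F. v \<in> F \<and> F \<inter> nbhd W v = {} \<and> True)
    \<le> decay ^ (card (nbhd W v) + 1) * total (W - insert v (nbhd W v))"
    using assms by (intro weight_isolated)
  also have "\<dots> \<le> decay ^ (card (nbhd W v) + 1)"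
    using assms(2) by (intro decay_mult_total_le IH) blast
  finally show ?thesis by simp
qed

lemma weight_out_le:
  assumes "finite W" "v \<in> W" "total (W - {v}) \<le> c"
  shows "weight W (\<lambda>F. v \<notin> F) \<le> decay * c"
proof -
  have "decay * total (W - {v}) \<le> decay * c"
    using assms(3) decay_pos by (intro mult_left_mono) auto
  then show ?thesis using weight_out[OF assms(1,2)] by linarith
qed

lemma total_split:
  assumes "finite W"
  shows "total W \<le> weight W (\<lambda>F. v \<notin> F)
    + weight W (\<lambda>F. v \<in> F \<and> F \<inter> nbhd W v = {}) + weight W (\<lambda>F. v \<in> F \<and> F \<inter> nbhd W v \<noteq> {})"
proof -
  have "total W \<le> weight W (\<lambda>F. v \<notin> F) + weight W (\<lambda>F. v \<in> F)"
    using assms by (intro weight_le_disj) auto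
  moreover have "weight W (\<lambda>F. v \<in> F) \<le> weight W (\<lambda>F. v \<in> F \<and> F \<inter> nbhd W v = {})
      + weight W (\<lambda>F. v \<in> F \<and> F \<inter> nbhd W v \<noteq> {})"
    using assms by (intro weight_le_disj) auto
  ultimately show ?thesis by linarith
qed

text \<open>Every neighbour of \<open>v\<close> has degree at least 1, so degree d yields at most
  \<open>(d + 1) * decay ^ (d + 1)\<close>, largest at d = 1. The value, about 0.8165, is a gain
  whenever a vertex is known to lie in all sets counted.\<close>

lemma weight_member_le:
  assumes "finite W" "v \<in> W" and IH: "\<And>X. X \<subset> W \<Longrightarrow> total X \<le> 1"
  shows "weight W (\<lambda>F. v \<in> F) \<le> 2 * decay ^ 2"
proof -
  let ?d = "card (nbhd W v)"
  have "weight W (\<lambda>F. v \<in> F) \<le> weight W (\<lambda>F. v \<in> F \<and> F \<inter> nbhd W v = {})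
      + weight W (\<lambda>F. v \<in> F \<and> F \<inter> nbhd W v \<noteq> {})"
    using assms(1) by (intro weight_le_disj) auto
  also have "\<dots> \<le> decay ^ (?d + 1) + (\<Sum>u\<in>nbhd W v. decay ^ (?d + card (nbhd W u)))"
    using assms by (intro add_mono weight_isolated_le weight_paired_le)
  also have "(\<Sum>u\<in>nbhd W v. decay ^ (?d + card (nbhd W u))) \<le> (\<Sum>u\<in>nbhd W v. decay ^ (?d + 1))"
    using card_nbhd_pos[OF assms(1,2)] by (intro sum_mono decay_power_antimono) simp
  also have "decay ^ (?d + 1) + (\<Sum>u\<in>nbhd W v. decay ^ (?d + 1)) = real (?d + 1) * decay ^ (?d + 1)"
    by (simp add: algebra_simps)
  also have "\<dots> \<le> 2 * decay ^ 2" by (rule mult_decay_power_le) simp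
  finally show ?thesis by simp
qed

text \<open>Without \<open>w\<close> the leaf \<open>u\<close> has no neighbour in \<open>F\<close>
  and could be added.\<close>

lemma leaf_in_max_dissociation:
  assumes "finite W" "max_dissociation_set W E F" "u \<in> W" "nbhd W u = {w}" "w \<notin> F"
  shows "u \<in> F"
proof (rule ccontr)
  assume "u \<notin> F"
  have "F \<subseteq> W" using assms(2) by (simp add: max_dissociation_set_def dissociation_set_def)
  then have "\<not> E u x" if "x \<in> F" for x using that assms(4,5) by (auto simp: nbhd_def)
  then show False
    using \<open>u \<notin> F\<close> by (intro max_dissociation_extend[OF assms(1-3)]) auto
qed

text \<open>If \<open>w\<close> were isolated in \<open>F\<close>, the leaf \<open>u\<close> could
  be added as its partner.\<close>

lemma leaf_neighbour_paired:
  assumes "finite W" "max_dissociation_set W E F" "u \<in> W" "nbhd W u = {w}" "w \<in> F"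
  shows "F \<inter> nbhd W w \<noteq> {}"
proof
  assume empty: "F \<inter> nbhd W w = {}"
  have FW: "F \<subseteq> W" using assms(2) by (simp add: max_dissociation_set_def dissociation_set_def)
  have only: "x = w" if "x \<in> F" "E u x" for x using that assms(4) FW by (auto simp: nbhd_def)
  have "u \<in> nbhd W w" using assms(3,4) nbhd_sym by blast
  then have "u \<notin> F" using empty by blast
  then show False
  proof (intro max_dissociation_extend[OF assms(1-3)])
    fix x y assume "x \<in> F" "y \<in> F" "E u x"
    then show "\<not> E x y" using only empty FW by (auto simp: nbhd_def)
  qed (use only in blast)+
qed

lemma weight_leaf_neighbour:
  assumes "finite W" "u \<in> W" "nbhd W u = {w}"
  shows "weight W (\<lambda>F. w \<in> F) \<le> (\<Sum>y\<in>nbhd W w.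
    decay ^ (card (nbhd W w) + card (nbhd W y)) * total (W - (nbhd W w \<union> nbhd W y)))"
proof -
  have w: "w \<in> W" using assms(3) by (auto simp: nbhd_def)
  have "weight W (\<lambda>F. w \<in> F) \<le> weight W (\<lambda>F. w \<in> F \<and> F \<inter> nbhd W w \<noteq> {})"
    using assms leaf_neighbour_paired by (intro weight_mono) auto
  then show ?thesis using weight_paired[OF assms(1) w] by linarith
qed

text \<open>Leaving out \<open>w\<close> forces the leaf \<open>u\<close>, so two vertices are
  settled at once and \<open>decay ^ 2\<close> replaces \<open>decay\<close>.\<close>

lemma weight_leaf_neighbour_out:
  assumes "finite W" "u \<in> W" "nbhd W u = {w}"
  shows "weight W (\<lambda>F. w \<notin> F) \<le> decay ^ 2 * total (W - {u, w})"
proof -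
  have uw: "u \<noteq> w" "w \<in> W" using assms(3) self_notin_nbhd[of u W] by (auto simp: nbhd_def)
  have "weight W (\<lambda>F. w \<notin> F) \<le> weight W (\<lambda>F. F \<inter> {u, w} = {u} \<and> True)"
    using assms leaf_in_max_dissociation by (intro weight_mono) auto
  also have "\<dots> \<le> decay ^ card {u, w} * total (W - {u, w})"
    using assms uw by (intro weight_branch) auto
  finally show ?thesis using uw by (simp add: numeral_2_eq_2)
qed

text \<open>The branch with \<open>w\<close> isolated is empty by
  \<open>leaf_neighbour_paired\<close>. The totals are kept because the first one is estimated below
  1 in the 2-regular case.\<close>

lemma total_le_leaf:
  assumes "finite W" "u \<in> W" "nbhd W u = {w}"
  shows "total W \<le> decay ^ 2 * total (W - {u, w}) + (\<Sum>y\<in>nbhd W w.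
    decay ^ (card (nbhd W w) + card (nbhd W y)) * total (W - (nbhd W w \<union> nbhd W y)))"
proof -
  have "total W \<le> weight W (\<lambda>F. w \<notin> F) + weight W (\<lambda>F. w \<in> F)"
    using assms by (intro weight_le_disj) auto
  then show ?thesis using weight_leaf_neighbour[OF assms] weight_leaf_neighbour_out[OF assms] by linarith
qed

lemma total_isolated_le:
  assumes "finite W" "u \<in> W" "nbhd W u = {}" and IH: "\<And>X. X \<subset> W \<Longrightarrow> total X \<le> 1"
  shows "total W \<le> decay"
proof -
  have "total W \<le> weight W (\<lambda>F. u \<in> F \<and> F \<inter> nbhd W u = {})"
  proof (rule weight_mono)
    fix F assume F: "max_dissociation_set W E F"
    then have "F \<subseteq> W" by (simp add: max_dissociation_set_def dissociation_set_def)
    then have no: "\<not> E u x" if "x \<in> F" for x using that assms(3) by (auto simp: nbhd_def)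
    have "u \<in> F"
    proof (rule ccontr)
      assume "u \<notin> F"
      then show False using no by (intro max_dissociation_extend[OF assms(1) F assms(2)]) auto
    qed
    then show "u \<in> F \<and> F \<inter> nbhd W u = {}" using assms(3) by simp
  qed fact
  then show ?thesis using weight_isolated_le[OF assms(1,2) IH] assms(3) by simp
qed

text \<open>The constant rounds up \<open>decay ^ 2 + decay ^ 3 + decay ^ 4\<close>, from the worst
  case where \<open>w\<close> has degree 2. The other cases give \<open>decay\<close>,
  \<open>3 * decay ^ 3\<close>, \<open>2 * decay ^ 2\<close> and
  \<open>decay ^ 2 + decay ^ 4 + 2 * decay ^ 5\<close>, all smaller.\<close>

lemma total_leaf_le:
  assumes fin: "finite W" and u: "u \<in> W" "card (nbhd W u) \<le> 1"
    and IH: "\<And>X. X \<subset> W \<Longrightarrow> total X \<le> 1"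
  shows "total W \<le> 8358 / 10000"
proof (cases "nbhd W u = {}")
  case True
  have "total W \<le> decay" using fin u(1) True IH by (rule total_isolated_le)
  then show ?thesis using decay_le by linarith
next
  case False
  then obtain w where w: "nbhd W u = {w}"
    using u(2) finite_nbhd[OF fin] by (metis One_nat_def card_1_singletonE card_0_eq le_Suc_eq le_zero_eq)
  let ?d = "card (nbhd W w)"
  have wW: "w \<in> W" and uw: "u \<noteq> w" using w self_notin_nbhd[of u W] by (auto simp: nbhd_def)
  have uN: "u \<in> nbhd W w" using u(1) w nbhd_sym by blast
  have d1: "?d \<ge> 1" using uN finite_nbhd[OF fin] by (metis One_nat_def Suc_leI card_gt_0_iff empty_iff)
  let ?s = "\<Sum>y\<in>nbhd W w. decay ^ (?d + card (nbhd W y))"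
  have "weight W (\<lambda>F. w \<in> F) \<le> weight W (\<lambda>F. w \<in> F \<and> F \<inter> nbhd W w \<noteq> {})"
    using fin u(1) w leaf_neighbour_paired by (intro weight_mono) auto
  also have "\<dots> \<le> ?s" using fin wW IH by (rule weight_paired_le)
  finally have win: "weight W (\<lambda>F. w \<in> F) \<le> ?s" .
  have split: "total W \<le> weight W (\<lambda>F. w \<notin> F) + weight W (\<lambda>F. w \<in> F)"
    using fin by (intro weight_le_disj) auto
  show ?thesis
  \<comment> \<open>With a second leaf \<open>u'\<close> at \<open>w\<close>, leaving out
    \<open>w\<close> forces both leaves and settles three vertices. Otherwise every neighbour of
    \<open>w\<close> except \<open>u\<close> has degree at least 2, which lowers the paired
    terms.\<close>
  proof (cases "\<exists>u'\<in>nbhd W w. u' \<noteq> u \<and> nbhd W u' = {w}")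
    case True
    then obtain u' where u': "u' \<in> nbhd W w" "u' \<noteq> u" "nbhd W u' = {w}" by blast
    have u'W: "u' \<in> W" "u' \<noteq> w" using u' self_notin_nbhd[of w W] by (auto simp: nbhd_def)
    have "weight W (\<lambda>F. w \<notin> F) \<le> weight W (\<lambda>F. F \<inter> {u, u', w} = {u, u'} \<and> True)"
      using leaf_in_max_dissociation[OF fin _ u(1) w] leaf_in_max_dissociation[OF fin _ u'W(1) u'(3)]
      by (intro weight_mono fin) auto
    also have "\<dots> \<le> decay ^ card {u, u', w} * total (W - {u, u', w})"
      using fin u(1) u'W wW w u' by (intro weight_branch) auto
    also have "\<dots> \<le> decay ^ card {u, u', w}"
      using wW by (intro decay_mult_total_le IH) auto
    finally have out: "weight W (\<lambda>F. w \<notin> F) \<le> decay ^ 3"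
      using uw u'W(2) u'(2) by (simp add: eval_nat_numeral)
    have "{u, u'} \<subseteq> nbhd W w" using uN u'(1) by simp
    then have "card {u, u'} \<le> ?d" by (intro card_mono finite_nbhd fin)
    then have d2: "2 \<le> ?d" using u'(2) by simp
    have "?s \<le> (\<Sum>y\<in>nbhd W w. decay ^ (?d + 1))"
      using card_nbhd_pos[OF fin wW] by (intro sum_mono decay_power_antimono) simp
    also have "\<dots> = decay * (real ?d * decay ^ ?d)" by (simp add: algebra_simps)
    also have "\<dots> \<le> decay * (2 * decay ^ 2)"
      using mult_decay_power_antimono[OF _ d2] decay_pos by (intro mult_left_mono) auto
    also have "\<dots> = 2 * decay ^ 3" by (simp add: eval_nat_numeral)
    finally show ?thesis using win split out decay3_le by linarith
  next
    case False
    have "weight W (\<lambda>F. w \<notin> F) \<le> decay ^ 2 * total (W - {u, w})"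
      using fin u(1) w by (rule weight_leaf_neighbour_out)
    also have "\<dots> \<le> decay ^ 2" using wW by (intro decay_mult_total_le IH) auto
    finally have out: "weight W (\<lambda>F. w \<notin> F) \<le> decay ^ 2" .
    have deg2: "2 \<le> card (nbhd W y)" if "y \<in> nbhd W w - {u}" for y
    proof -
      have "w \<in> nbhd W y" using that wW nbhd_sym by blast
      moreover have "nbhd W y \<noteq> {w}" using that False by blast
      ultimately obtain z where "z \<in> nbhd W y" "z \<noteq> w" by blast
      then have "card {z, w} \<le> card (nbhd W y)"
        using \<open>w \<in> nbhd W y\<close> by (intro card_mono finite_nbhd fin) auto
      then show ?thesis using \<open>z \<noteq> w\<close> by simp
    qed
    have "?s = decay ^ (?d + 1) + (\<Sum>y\<in>nbhd W w - {u}. decay ^ (?d + card (nbhd W y)))"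
      using uN w by (subst sum.remove[OF _ uN]) (auto simp: finite_nbhd fin)
    also have "(\<Sum>y\<in>nbhd W w - {u}. decay ^ (?d + card (nbhd W y)))
        \<le> (\<Sum>y\<in>nbhd W w - {u}. decay ^ (?d + 2))"
      using deg2 by (intro sum_mono decay_power_antimono) simp
    also have "(\<Sum>y\<in>nbhd W w - {u}. decay ^ (?d + 2)) = real (?d - 1) * decay ^ (?d + 2)"
      using uN by (simp add: finite_nbhd fin)
    finally have s: "?s \<le> decay ^ (?d + 1) + real (?d - 1) * decay ^ (?d + 2)" by simp
    consider "?d = 1" | "?d = 2" | "?d \<ge> 3" using d1 by linarith
    then show ?thesis
    proof cases
      case 1
      then have "?s \<le> decay ^ 2" using s by (simp add: numeral_2_eq_2)
      then show ?thesis using win split out decay2_le by linarith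
    next
      case 2
      then have "?s \<le> decay ^ 3 + decay ^ 4" using s by (simp add: eval_nat_numeral)
      then show ?thesis using win split out decay2_le decay3_le decay4 by linarith
    next
      case 3
      have "decay ^ (?d + 1) \<le> decay ^ 4" using 3 by (intro decay_power_antimono) simp
      moreover have "real (?d - 1) * decay ^ (?d + 2) \<le> 2 * decay ^ 5"
      proof -
        \<comment> \<open>Splitting off \<open>decay ^ 3\<close> makes exponent and coefficient
          agree, both \<open>?d - 1\<close>, which is at least 2 as
          \<open>mult_decay_power_antimono\<close> requires.\<close>
        have "decay ^ (?d + 2) = decay ^ 3 * decay ^ (?d - 1)"
          using 3 by (simp flip: power_add)
        moreover have "decay ^ 3 * (real (?d - 1) * decay ^ (?d - 1)) \<le> decay ^ 3 * (real 2 * decay ^ 2)"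
          using 3 decay_pos by (intro mult_left_mono mult_decay_power_antimono) auto
        moreover have "decay ^ 3 * (real 2 * decay ^ 2) = 2 * decay ^ 5"
          by (simp flip: power_add)
        ultimately show ?thesis by (simp add: algebra_simps)
      qed
      ultimately show ?thesis using s win split out decay2_le decay4 decay5 decay_le by linarith
    qed
  qed
qed

subsection \<open>Vertices of larger degree and 2-regular graphs\<close>

text \<open>A neighbour of degree 2 becomes a leaf of \<open>W - {v}\<close>, and the bound is
  \<open>0.8358 * decay + decay ^ 5 + 4 * decay ^ 6\<close>, about 0.913. If all neighbours have
  degree at least 3, it is \<open>decay + decay ^ 5 + 4 * decay ^ 7\<close>, about 0.919.\<close>

lemma total_degree_ge_4:
  assumes fin: "finite W" and v: "v \<in> W" "4 \<le> card (nbhd W v)"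
    and deg: "\<And>u. u \<in> nbhd W v \<Longrightarrow> 2 \<le> card (nbhd W u)"
    and IH: "\<And>X. X \<subset> W \<Longrightarrow> total X \<le> 1"
  shows "total W < 1"
proof -
  let ?d = "card (nbhd W v)"
  let ?s = "\<Sum>u\<in>nbhd W v. decay ^ (?d + card (nbhd W u))"
  have sum_le: "?s \<le> decay ^ m * (4 * decay ^ 4)" if "\<And>u. u \<in> nbhd W v \<Longrightarrow> m \<le> card (nbhd W u)" for m
  proof -
    have "?s \<le> (\<Sum>u\<in>nbhd W v. decay ^ (?d + m))"
      using that by (intro sum_mono decay_power_antimono) simp
    also have "\<dots> = decay ^ m * (real ?d * decay ^ ?d)" by (simp add: power_add)
    also have "\<dots> \<le> decay ^ m * (real 4 * decay ^ 4)"
      using v(2) decay_pos by (intro mult_left_mono mult_decay_power_antimono) auto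
    finally show ?thesis by simp
  qed
  have paired: "weight W (\<lambda>F. v \<in> F \<and> F \<inter> nbhd W v \<noteq> {}) \<le> ?s"
    using fin v(1) IH by (rule weight_paired_le)
  have "weight W (\<lambda>F. v \<in> F \<and> F \<inter> nbhd W v = {}) \<le> decay ^ (?d + 1)"
    using fin v(1) IH by (rule weight_isolated_le)
  also have "\<dots> \<le> decay ^ 5" using v(2) by (intro decay_power_antimono) simp
  finally have isolated: "weight W (\<lambda>F. v \<in> F \<and> F \<inter> nbhd W v = {}) \<le> decay ^ 5" .
  note split = total_split[OF fin, of v]
  show ?thesis
  proof (cases "\<exists>u\<in>nbhd W v. card (nbhd W u) = 2")
    case True
    then obtain u where u: "u \<in> nbhd W v" "card (nbhd W u) = 2" by blast
    have "total (W - {v}) \<le> 8358 / 10000"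
    proof (rule total_leaf_le)
      show "u \<in> W - {v}" using u(1) self_notin_nbhd[of v W] nbhd_subset by blast
      show "card (nbhd (W - {v}) u) \<le> 1"
        using u(2) nbhd_sym[OF v(1) u(1)] by (simp add: nbhd_Diff)
    qed (use fin IH in auto)
    then have "weight W (\<lambda>F. v \<notin> F) \<le> decay * (8358 / 10000)" using fin v(1) by (intro weight_out_le)
    moreover have "?s \<le> decay ^ 2 * (4 * decay ^ 4)" using deg by (rule sum_le)
    ultimately show ?thesis
      using split paired isolated decay5 decay4 decay_le decay2_le by simp
  next
    case False
    have "weight W (\<lambda>F. v \<notin> F) \<le> decay * 1"
      using fin v(1) by (intro weight_out_le IH) auto
    moreover have "?s \<le> decay ^ 3 * (4 * decay ^ 4)"
    proof (rule sum_le)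
      fix u assume u: "u \<in> nbhd W v"
      then have "card (nbhd W u) \<noteq> 2" using False by blast
      then show "3 \<le> card (nbhd W u)" using deg[OF u] by simp
    qed
    ultimately show ?thesis
      using split paired isolated decay5 decay4 decay_le decay3_le by simp
  qed
qed

text \<open>\<open>u\<close> becomes a leaf of \<open>W - {v}\<close>, so the branch without
  \<open>v\<close> is at most \<open>0.8358 * decay\<close>. The sharper second bound serves the
  generic case of \<open>total_cubic\<close>, where 0.99 would be too large.\<close>

lemma total_degree_3:
  assumes fin: "finite W" and v: "v \<in> W" "card (nbhd W v) = 3"
    and deg: "\<And>u. u \<in> nbhd W v \<Longrightarrow> 2 \<le> card (nbhd W u)"
    and u: "u \<in> nbhd W v" "card (nbhd W u) = 2"
    and IH: "\<And>X. X \<subset> W \<Longrightarrow> total X \<le> 1"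
  shows "total W \<le> 99 / 100"
    and "u' \<in> nbhd W v \<Longrightarrow> 3 \<le> card (nbhd W u') \<Longrightarrow> total W \<le> 982 / 1000"
proof -
  let ?s = "\<Sum>u\<in>nbhd W v. decay ^ (3 + card (nbhd W u))"
  have finN: "finite (nbhd W v)" using fin by (rule finite_nbhd)
  have uW: "u \<in> W" "u \<noteq> v" "v \<in> nbhd W u"
    using u(1) self_notin_nbhd[of v W] nbhd_subset nbhd_sym[OF v(1)] by blast+
  have paired: "weight W (\<lambda>F. v \<in> F \<and> F \<inter> nbhd W v \<noteq> {}) \<le> ?s"
    using weight_paired_le[OF fin v(1) IH] v(2) by simp
  have "total (W - {v}) \<le> 8358 / 10000"
  proof (rule total_leaf_le)
    show "u \<in> W - {v}" using uW by blast
    show "card (nbhd (W - {v}) u) \<le> 1" using u(2) uW by (simp add: nbhd_Diff)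
  qed (use fin IH in auto)
  then have out: "weight W (\<lambda>F. v \<notin> F) \<le> decay * (8358 / 10000)" using fin v(1) by (intro weight_out_le)
  note split = total_split[OF fin, of v]
  show mixed: "total W \<le> 982 / 1000" if u': "u' \<in> nbhd W v" "3 \<le> card (nbhd W u')" for u'
  proof -
    have isolated: "weight W (\<lambda>F. v \<in> F \<and> F \<inter> nbhd W v = {}) \<le> decay ^ 4"
      using weight_isolated_le[OF fin v(1) IH] v(2) by simp
    \<comment> \<open>The paired exponents are at least 6, 5, 5; with \<open>decay ^ 4\<close> for
      the isolated branch the sum is about 0.9817.\<close>
    have "?s = decay ^ (3 + card (nbhd W u')) + (\<Sum>u\<in>nbhd W v - {u'}. decay ^ (3 + card (nbhd W u)))"
      using finN u'(1) by (rule sum.remove)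
    also have "decay ^ (3 + card (nbhd W u')) \<le> decay ^ 6"
      using u'(2) by (intro decay_power_antimono) simp
    also have "(\<Sum>u\<in>nbhd W v - {u'}. decay ^ (3 + card (nbhd W u))) \<le> (\<Sum>u\<in>nbhd W v - {u'}. decay ^ 5)"
      using deg by (intro sum_mono decay_power_antimono) auto
    also have "\<dots> = 2 * decay ^ 5" using finN u'(1) v(2) by simp
    finally have "?s \<le> decay ^ 6 + 2 * decay ^ 5" by simp
    then show ?thesis
      using split paired isolated out decay4 decay5 decay6 decay_le decay2_le by linarith
  qed
  show "total W \<le> 99 / 100"
  proof (cases "\<exists>u'\<in>nbhd W v. 3 \<le> card (nbhd W u')")
    case True
    then obtain u' where "u' \<in> nbhd W v" "3 \<le> card (nbhd W u')" by blast
    then have "total W \<le> 982 / 1000" by (rule mixed)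
    then show ?thesis by linarith
  next
    case False
    \<comment> \<open>With three neighbours of degree 2, the plain bound \<open>decay ^ 4\<close>
      for the isolated branch would give about 1.02. The second neighbour \<open>w\<close> of
      \<open>u\<close>, outside \<open>nbhd W v\<close> by triangle-freeness, is forced into
      \<open>F\<close> there and contributes the extra factor \<open>2 * decay ^ 2\<close>.\<close>
    have "card (nbhd W u - {v}) = 1" using u(2) uW by simp
    then obtain w where w: "nbhd W u - {v} = {w}" by (rule card_1_singletonE)
    have wN: "w \<in> W" "w \<noteq> v" "w \<notin> nbhd W v" "nbhd W u = {v, w}"
      using w uW(3) u(1) no_triangle unfolding nbhd_def by blast+
    let ?H = "W - insert v (nbhd W v)"
    have "weight W (\<lambda>F. v \<in> F \<and> F \<inter> nbhd W v = {})
        \<le> weight W (\<lambda>F. v \<in> F \<and> F \<inter> nbhd W v = {} \<and> w \<in> F - insert v (nbhd W v))"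
    proof (rule weight_mono)
      fix F assume F: "max_dissociation_set W E F" "v \<in> F \<and> F \<inter> nbhd W v = {}"
      then have FW: "F \<subseteq> W" by (simp add: max_dissociation_set_def dissociation_set_def)
      \<comment> \<open>otherwise \<open>u\<close> could be paired with \<open>v\<close>, contradicting maximality\<close>
      have "w \<in> F"
      proof (rule ccontr)
        assume "w \<notin> F"
        then have "x = v" if "x \<in> F" "E u x" for x using that FW wN(4) by (auto simp: nbhd_def)
        then show False using F(2) FW u(1)
          by (intro max_dissociation_extend[OF fin F(1) uW(1)]) (auto simp: nbhd_def)
      qed
      then show "v \<in> F \<and> F \<inter> nbhd W v = {} \<and> w \<in> F - insert v (nbhd W v)" using F(2) wN by blast
    qed (rule fin)
    also have "\<dots> \<le> decay ^ 4 * weight ?H (\<lambda>F. w \<in> F)"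
      using weight_isolated[OF fin v(1), of "\<lambda>F. w \<in> F"] v(2) by simp
    also have "\<dots> \<le> decay ^ 4 * (2 * decay ^ 2)"
      using wN fin decay_pos by (intro mult_left_mono weight_member_le IH) auto
    finally have isolated: "weight W (\<lambda>F. v \<in> F \<and> F \<inter> nbhd W v = {}) \<le> decay ^ 4 * (2 * decay ^ 2)" .
    have "?s \<le> (\<Sum>u\<in>nbhd W v. decay ^ 5)"
      using deg by (intro sum_mono decay_power_antimono) simp
    also have "\<dots> = 3 * decay ^ 5" using v(2) by simp
    finally show ?thesis
      using split paired isolated out decay4 decay5 decay_le decay2_le by simp
  qed
qed

text \<open>Deleting \<open>v\<close> leaves degree 2 at its neighbour \<open>u\<close>, while
  another neighbour \<open>y\<close> of \<open>u\<close>, not adjacent to \<open>v\<close> by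
  triangle-freeness, keeps degree 3. So \<open>total_degree_3\<close> applies at \<open>y\<close> in
  \<open>W - {v}\<close>; the paired branch adds \<open>3 * decay ^ 6\<close>.\<close>

lemma total_cubic:
  assumes fin: "finite W" and v: "v \<in> W" "card (nbhd W v) = 3"
    and deg: "\<And>a b. a \<in> W \<Longrightarrow> card (nbhd W a) = 3 \<Longrightarrow> b \<in> nbhd W a \<Longrightarrow> card (nbhd W b) = 3"
    and IH: "\<And>X. X \<subset> W \<Longrightarrow> total X \<le> 1"
  shows "total W < 1"
proof -
  let ?W = "W - {v}"
  have finN: "finite (nbhd W x)" for x using fin by (rule finite_nbhd)
  have "nbhd W v \<noteq> {}" using v(2) by auto
  then obtain u where u: "u \<in> nbhd W v" by blast
  have uW: "u \<in> W" "card (nbhd W u) = 3" "v \<in> nbhd W u" "u \<noteq> v"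
    using u nbhd_subset deg[OF v u] nbhd_sym[OF v(1)] self_notin_nbhd[of v W] by blast+
  have "card (nbhd W u - {v}) = 2" using uW by simp
  then have "nbhd W u - {v} \<noteq> {}" by (metis card.empty zero_neq_numeral)
  then obtain y where y: "y \<in> nbhd W u" "y \<noteq> v" by blast
  have yW: "y \<in> W" "card (nbhd W y) = 3" "u \<in> nbhd W y"
    using y nbhd_subset deg[OF uW(1,2) y(1)] nbhd_sym[OF uW(1)] by blast+
  have vy: "v \<notin> nbhd W y" "y \<notin> nbhd W v"
    using u y no_triangle sym unfolding nbhd_def by blast+
  have y': "card (nbhd ?W y) = 3" "nbhd ?W y = nbhd W y" using vy yW(2) by (simp_all add: nbhd_Diff)
  have deg': "2 \<le> card (nbhd ?W z)" if "z \<in> nbhd ?W y" for z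
  proof -
    have "card (nbhd W z) = 3" using deg[OF yW(1,2)] that y'(2) by simp
    then show ?thesis using diff_card_le_card_Diff[of "{v}" "nbhd W z"] by (simp add: nbhd_Diff)
  qed
  have u': "u \<in> nbhd ?W y" "card (nbhd ?W u) = 2" using uW yW y'(2) by (simp_all add: nbhd_Diff)
  have IH': "total X \<le> 1" if "X \<subset> ?W" for X using IH that by blast
  note degree_3 = total_degree_3[OF _ _ y'(1) deg' u' IH']
  have "(\<Sum>a\<in>nbhd W v. decay ^ (card (nbhd W v) + card (nbhd W a))) = (\<Sum>a\<in>nbhd W v. decay ^ 6)"
    using deg[OF v] v(2) by (intro sum.cong) simp_all
  also have "\<dots> = 3 * decay ^ 6" using v(2) by simp
  finally have paired: "weight W (\<lambda>F. v \<in> F \<and> F \<inter> nbhd W v \<noteq> {}) \<le> 3 * decay ^ 6"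
    using weight_paired_le[OF fin v(1) IH] by simp
  note split = total_split[OF fin, of v]
  \<comment> \<open>If \<open>N(y) = N(v)\<close>, only the weaker bound 0.99 is available for \<open>W - {v}\<close>, but \<open>y\<close> becomes isolated in \<open>W - N[v]\<close>.\<close>
  show ?thesis
  proof (cases "nbhd W y = nbhd W v")
    case True
    let ?H = "W - insert v (nbhd W v)"
    have "total ?H \<le> decay"
    proof (rule total_isolated_le)
      show "y \<in> ?H" using yW(1) y(2) vy(2) by blast
      show "nbhd ?H y = {}" using True by (auto simp: nbhd_Diff)
    qed (use fin IH in auto)
    then have "decay ^ 4 * total ?H \<le> decay ^ 4 * decay"
      using decay_pos by (intro mult_left_mono) auto
    then have isolated: "weight W (\<lambda>F. v \<in> F \<and> F \<inter> nbhd W v = {}) \<le> decay ^ 4 * decay"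
      using weight_isolated[OF fin v(1), of "\<lambda>_. True"] v(2) by simp
    have "total ?W \<le> 99 / 100" using fin yW(1) y(2) by (intro degree_3(1)) auto
    then have "weight W (\<lambda>F. v \<notin> F) \<le> decay * (99 / 100)" using fin v(1) by (intro weight_out_le)
    then show ?thesis
      using split paired isolated decay6 decay_le decay2_le unfolding decay4 by linarith
  next
    case False
    \<comment> \<open>Equal sizes yield a \<open>z\<close> in \<open>nbhd W y\<close> not adjacent
      to \<open>v\<close>. It keeps degree 3 in \<open>?W\<close>, which permits 0.982: the sum is
      about 0.998, whereas 0.99 would give about 1.003.\<close>
    have "\<not> nbhd W y \<subseteq> nbhd W v"
      using card_subset_eq[OF finN] False yW(2) v(2) by metis
    then obtain z where z: "z \<in> nbhd W y" "z \<notin> nbhd W v" by blast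
    have "v \<notin> nbhd W z" using z sym nbhd_subset unfolding nbhd_def by blast
    then have z3: "3 \<le> card (nbhd ?W z)" using deg[OF yW(1,2) z(1)] by (simp add: nbhd_Diff)
    have "total ?W \<le> 982 / 1000" using fin yW(1) y(2) z(1) y'(2) z3 by (intro degree_3(2)[of z]) auto
    then have "weight W (\<lambda>F. v \<notin> F) \<le> decay * (982 / 1000)" using fin v(1) by (intro weight_out_le)
    moreover have "weight W (\<lambda>F. v \<in> F \<and> F \<inter> nbhd W v = {}) \<le> decay ^ 4"
      using weight_isolated_le[OF fin v(1) IH] v(2) by simp
    ultimately show ?thesis
      using split paired decay6 decay_le decay2_le unfolding decay4 by linarith
  qed
qed

text \<open>The neighbourhoods are taken in \<open>W\<close>, so the four equations exclude chords
  as well as edges leaving \<open>C\<close>: the cycle is a whole component of the subgraph induced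
  by \<open>W\<close>.\<close>

definition c4_component :: "'a set \<Rightarrow> 'a set \<Rightarrow> bool" where
  "c4_component W C \<longleftrightarrow> (\<exists>a b c d. distinct [a, b, c, d] \<and> C = {a, b, c, d} \<and> C \<subseteq> W \<and>
     nbhd W a = {b, d} \<and> nbhd W b = {a, c} \<and> nbhd W c = {b, d} \<and> nbhd W d = {a, c})"

text \<open>Follow the path a'', a', a, v, b, b'. It closes to a C4 when \<open>a' = b'\<close>.
  Otherwise all three branches at \<open>v\<close> gain from low-degree or forced vertices, and the
  bounds 0.491, 0.213 and 0.279 add up to about 0.983.\<close>

lemma total_2_regular:
  assumes fin: "finite W" and v: "v \<in> W"
    and deg: "\<And>a. a \<in> W \<Longrightarrow> card (nbhd W a) = 2"
    and IH: "\<And>X. X \<subset> W \<Longrightarrow> total X \<le> 1"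
  shows "total W < 1 \<or> (\<exists>C. c4_component W C)"
proof -
  have other: "\<exists>y. nbhd W x = {z, y} \<and> y \<noteq> z \<and> y \<in> W" if "x \<in> W" "z \<in> nbhd W x" for x z
  proof -
    have "card (nbhd W x - {z}) = 1" using deg[OF that(1)] that(2) by simp
    then obtain y where "nbhd W x - {z} = {y}" by (rule card_1_singletonE)
    then show ?thesis using that(2) nbhd_subset by blast
  qed
  have "nbhd W v \<noteq> {}" using deg[OF v] by auto
  then obtain a where "a \<in> nbhd W v" by blast
  then obtain b where Nv: "nbhd W v = {a, b}" "b \<noteq> a" "a \<in> W" "b \<in> W"
    using other[OF v] nbhd_subset by blast
  obtain a' where Na: "nbhd W a = {v, a'}" "a' \<noteq> v" "a' \<in> W"
    using other[OF Nv(3), of v] nbhd_sym[OF v] Nv(1) by blast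
  obtain b' where Nb: "nbhd W b = {v, b'}" "b' \<noteq> v" "b' \<in> W"
    using other[OF Nv(4), of v] nbhd_sym[OF v] Nv(1) by blast
  obtain a'' where Na': "nbhd W a' = {a, a''}" "a'' \<noteq> a" "a'' \<in> W"
    using other[OF Na(3), of a] nbhd_sym[OF Nv(3)] Na(1) by blast
  have bb': "b \<in> nbhd W b'" using nbhd_sym[OF Nv(4)] Nb(1) by blast
  have edges: "E v a" "E v b" "E a v" "E a a'" "E b v" "E b b'" "E a' a" "E a' a''" "E b' b"
    using Nv(1) Na(1) Nb(1) Na'(1) bb' unfolding nbhd_def by blast+
  have ne: "a \<noteq> v" "b \<noteq> v" "a' \<noteq> a" "b' \<noteq> b" "a' \<noteq> b" "b' \<noteq> a"
    using edges irrefl no_triangle by blast+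
  show ?thesis
  proof (cases "a' = b'")
    case True
    then have "b \<in> {a, a''}" using bb' Na'(1) by blast
    then have "nbhd W a' = {a, b}" using Na'(1) Nv(2) by blast
    moreover have "distinct [v, a, a', b]" "{v, a, a', b} \<subseteq> W" "nbhd W b = {v, a'}"
      using Nv Na Nb v ne True by auto
    ultimately have "c4_component W {v, a, a', b}"
      unfolding c4_component_def using Nv(1) Na(1)
      by - (rule exI[of _ v], rule exI[of _ a], rule exI[of _ a'], rule exI[of _ b], simp)
    then show ?thesis by blast
  next
    case False
    \<comment> \<open>The cycle now has length at least 5, so \<open>a''\<close> is neither
      \<open>v\<close> nor adjacent to \<open>v\<close> and keeps degree 2 in
      \<open>?W\<close>.\<close>
    have a'': "a'' \<noteq> v" "a'' \<noteq> b" "v \<notin> nbhd W a''"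
    proof -
      have *: "a' \<in> nbhd W a''" using nbhd_sym[OF Na(3)] Na'(1) by blast
      then show "a'' \<noteq> v" using Nv(1) ne by blast
      show "a'' \<noteq> b" using * Nb(1) Na(2) False by blast
      show "v \<notin> nbhd W a''"
      proof
        assume "v \<in> nbhd W a''"
        then have "a'' \<in> nbhd W v" using nbhd_sym Na'(3) by blast
        then show False using Nv(1) Na'(2) \<open>a'' \<noteq> b\<close> by blast
      qed
    qed
    let ?W = "W - {v}"
    have NW: "nbhd ?W a = {a'}" "nbhd ?W a' = {a, a''}" "card (nbhd ?W a'') = 2"
      using Na Na' ne a'' deg[OF Na'(3)] by (auto simp: nbhd_Diff)
    \<comment> \<open>In \<open>?W\<close> the vertex \<open>a\<close> is a leaf at
      \<open>a'\<close>. After both are removed, \<open>b\<close> has lost \<open>v\<close> and has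
      degree at most 1, which improves the leading term of \<open>total_le_leaf\<close>.\<close>
    have "total (?W - {a, a'}) \<le> 8358 / 10000"
    proof (rule total_leaf_le)
      show "b \<in> ?W - {a, a'}" using Nv ne by blast
      have "nbhd (?W - {a, a'}) b \<subseteq> {b'}" using Nb(1) by (auto simp: nbhd_Diff)
      then have "card (nbhd (?W - {a, a'}) b) \<le> card {b'}" by (intro card_mono) auto
      then show "card (nbhd (?W - {a, a'}) b) \<le> 1" by simp
    qed (use fin IH in auto)
    then have first: "decay ^ 2 * total (?W - {a, a'}) \<le> decay ^ 2 * (8358 / 10000)"
      using decay_pos by (intro mult_left_mono) auto
    have "(\<Sum>y\<in>nbhd ?W a'. decay ^ (card (nbhd ?W a') + card (nbhd ?W y)) * total (?W - (nbhd ?W a' \<union> nbhd ?W y)))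
        \<le> (\<Sum>y\<in>nbhd ?W a'. decay ^ (card (nbhd ?W a') + card (nbhd ?W y)))"
      using v by (intro sum_mono decay_mult_total_le IH) blast
    also have "\<dots> = decay ^ 3 + decay ^ 4" using NW Na'(2) by (simp add: eval_nat_numeral)
    finally have "total ?W \<le> decay ^ 2 * (8358 / 10000) + (decay ^ 3 + decay ^ 4)"
      using total_le_leaf[of ?W a a'] fin Nv(3) ne(1) NW(1) first by simp
    \<comment> \<open>The constant rounds up 0.40825 * 0.8358 + 0.260852 + 1/6.\<close>
    then have "total ?W \<le> 768736 / 1000000" using decay2_le decay3_le decay4 by simp
    then have out: "weight W (\<lambda>F. v \<notin> F) \<le> decay * (768736 / 1000000)" using fin v by (intro weight_out_le)
    let ?H = "W - insert v (nbhd W v)"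
    have "weight W (\<lambda>F. v \<in> F \<and> F \<inter> nbhd W v = {})
        \<le> weight W (\<lambda>F. v \<in> F \<and> F \<inter> nbhd W v = {} \<and> a' \<in> F - insert v (nbhd W v))"
    proof (rule weight_mono)
      fix F assume F: "max_dissociation_set W E F" "v \<in> F \<and> F \<inter> nbhd W v = {}"
      then have FW: "F \<subseteq> W" by (simp add: max_dissociation_set_def dissociation_set_def)
      \<comment> \<open>otherwise \<open>a\<close> could be paired with \<open>v\<close>\<close>
      have "a' \<in> F"
      proof (rule ccontr)
        assume "a' \<notin> F"
        then have "x = v" if "x \<in> F" "E a x" for x using that FW Na(1) by (auto simp: nbhd_def)
        moreover have "\<not> E v x" if "x \<in> F" for x using that F(2) FW by (auto simp: nbhd_def)
        moreover have "a \<notin> F" using F(2) Nv(1) by blast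
        ultimately show False by (intro max_dissociation_extend[OF fin F(1) Nv(3)]) blast+
      qed
      then show "v \<in> F \<and> F \<inter> nbhd W v = {} \<and> a' \<in> F - insert v (nbhd W v)"
        using F(2) Nv(1) Na(2) ne by blast
    qed (rule fin)
    also have "\<dots> \<le> decay ^ 3 * weight ?H (\<lambda>F. a' \<in> F)"
      using weight_isolated[OF fin v, of "\<lambda>F. a' \<in> F"] deg[OF v] by (simp add: numeral_3_eq_3)
    also have "\<dots> \<le> decay ^ 3 * (2 * decay ^ 2)"
      using Na(2,3) Nv(1) ne v fin decay_pos by (intro mult_left_mono weight_member_le IH) auto
    also have "\<dots> = 2 * decay ^ 5" by (simp flip: power_add)
    finally have isolated: "weight W (\<lambda>F. v \<in> F \<and> F \<inter> nbhd W v = {}) \<le> 2 * decay ^ 5" .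
    \<comment> \<open>Deleting \<open>nbhd W v\<close>, that is a and b, takes the neighbour
      \<open>z\<close> away from \<open>y\<close>, which is left with degree at most 1. The witness
      \<open>y\<close> is b' when \<open>v\<close> is paired with a, and a' when it is paired with
      b.\<close>
    have leaf: "total (W - (nbhd W v \<union> nbhd W x)) \<le> 8358 / 10000"
      if "x \<in> {a, b}" "y \<in> W" "y \<notin> nbhd W v \<union> nbhd W x" "z \<in> nbhd W y" "z \<in> {a, b}" for x y z
    proof (rule total_leaf_le)
      show "y \<in> W - (nbhd W v \<union> nbhd W x)" using that by blast
      have "nbhd (W - (nbhd W v \<union> nbhd W x)) y \<subseteq> nbhd W y - {z}"
        using that(5) Nv(1) by (auto simp: nbhd_Diff)
      moreover have "card (nbhd W y - {z}) = 1" using deg[OF that(2)] that(4) by simp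
      ultimately show "card (nbhd (W - (nbhd W v \<union> nbhd W x)) y) \<le> 1"
        by (metis card.infinite card_mono zero_neq_one)
    qed (use fin IH Nv in auto)
    have "total (W - (nbhd W v \<union> nbhd W a)) \<le> 8358 / 10000"
      by (rule leaf[of a b' b]) (use Nv Na Nb ne False bb' in auto)
    moreover have "total (W - (nbhd W v \<union> nbhd W b)) \<le> 8358 / 10000"
      by (rule leaf[of b a' a]) (use Nv Na Nb Na' ne False in auto)
    ultimately have "(\<Sum>u\<in>nbhd W v. decay ^ (card (nbhd W v) + card (nbhd W u)) * total (W - (nbhd W v \<union> nbhd W u)))
        \<le> (\<Sum>u\<in>nbhd W v. decay ^ 4 * (8358 / 10000))"
      using Nv deg[OF v] deg[OF Nv(3)] deg[OF Nv(4)] decay_pos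
      by (intro sum_mono mult_mono) (auto intro: weight_nonneg simp: eval_nat_numeral)
    also have "\<dots> = 2 * (decay ^ 4 * (8358 / 10000))" using Nv by simp
    finally have "weight W (\<lambda>F. v \<in> F \<and> F \<inter> nbhd W v \<noteq> {}) \<le> 2 * (decay ^ 4 * (8358 / 10000))"
      using weight_paired[OF fin v] by linarith
    then have "total W < 1"
      using total_split[OF fin, of v] out isolated decay5 decay_le unfolding decay4 by linarith
    then show ?thesis by blast
  qed
qed

subsection \<open>Components that are 4-cycles\<close>


lemma c4_componentE:
  assumes "c4_component W C"
  obtains a b c d where "distinct [a, b, c, d]" "C = {a, b, c, d}" "C \<subseteq> W"
    "nbhd W a = {b, d}" "nbhd W b = {a, c}" "nbhd W c = {b, d}" "nbhd W d = {a, c}"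
  using assms unfolding c4_component_def by (elim exE conjE) (rule that)

lemma c4_component_subset: "c4_component W C \<Longrightarrow> C \<subseteq> W"
  by (auto simp: c4_component_def)

lemma card_c4_component: "c4_component W C \<Longrightarrow> card C = 4"
  by (auto simp: c4_component_def)

lemma c4_component_Diff:
  assumes "c4_component W C"
  shows "W - C \<subset> W"
proof -
  have "C \<noteq> {}" using card_c4_component[OF assms] by auto
  then show ?thesis using c4_component_subset[OF assms] by blast
qed

lemma card_c4_Diff:
  assumes "finite W" "c4_component W C"
  shows "card W = 4 + card (W - C)"
  using c4_component_subset[OF assms(2)] card_c4_component[OF assms(2)] assms(1)
  by (metis card_Diff_subset card_mono finite_subset le_add_diff_inverse)

lemma c4_component_closed:
  assumes "c4_component W C" "x \<in> C" "y \<in> W - C"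
  shows "\<not> E x y" "\<not> E y x"
proof -
  have "nbhd W x \<subseteq> C" using assms(1)
  proof (rule c4_componentE)
    fix a b c d assume "C = {a, b, c, d}" "nbhd W a = {b, d}" "nbhd W b = {a, c}"
      "nbhd W c = {b, d}" "nbhd W d = {a, c}"
    then show ?thesis using assms(2) by auto
  qed
  then show "\<not> E x y" using assms(3) by (auto simp: nbhd_def)
  then show "\<not> E y x" using sym by blast
qed

text \<open>Two vertices induce maximum degree at most 1 whether adjacent or not, and no edge joins
  \<open>C\<close> to the rest.\<close>

lemma dissociation_c4_Un:
  assumes fin: "finite W" and C: "c4_component W C"
    and T: "T \<subseteq> C" "card T = 2" and F: "dissociation_set (W - C) E F"
  shows "dissociation_set W E (T \<union> F)" "card (T \<union> F) = 2 + card F"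
proof -
  have finD: "finite (W - C)" using fin by simp
  have FW: "F \<subseteq> W - C" and Fd: "\<And>v x y. \<lbrakk>v \<in> F; x \<in> F; y \<in> F; E v x; E v y\<rbrakk> \<Longrightarrow> x = y"
    using F unfolding dissociation_set_iff[OF finD] by blast+
  have CW: "C \<subseteq> W" using C by (rule c4_component_subset)
  have finT: "finite T" using T(1) CW fin by (meson finite_subset)
  have Td: "x = y" if "v \<in> T" "x \<in> T" "y \<in> T" "E v x" "E v y" for v x y
  proof (rule ccontr)
    assume "x \<noteq> y"
    moreover have "v \<noteq> x" "v \<noteq> y" using that(4,5) irrefl by blast+
    ultimately have "card {v, x, y} = 3" by simp
    moreover have "card {v, x, y} \<le> card T" using finT that by (intro card_mono) auto
    ultimately show False using T(2) by simp
  qed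
  have cross: "\<not> E t x" "\<not> E x t" if "t \<in> T" "x \<in> F" for t x
    using c4_component_closed[OF C] T(1) FW that by blast+
  show "dissociation_set W E (T \<union> F)"
    unfolding dissociation_set_iff[OF fin]
  proof (intro conjI ballI impI)
    show "T \<union> F \<subseteq> W" using T(1) FW CW by blast
  next
    fix v x y assume "v \<in> T \<union> F" "x \<in> T \<union> F" "y \<in> T \<union> F" "E v x" "E v y"
    then show "x = y" using cross Td Fd by blast
  qed
  show "card (T \<union> F) = 2 + card F"
    using T FW finT finD by (subst card_Un_disjoint) (auto intro: finite_subset)
qed

lemma dissociation_c4_split:
  assumes fin: "finite W" and C: "c4_component W C" and G: "dissociation_set W E G"
  shows "dissociation_set (W - C) E (G - C)" "card (G \<inter> C) \<le> 2"
proof -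
  have finD: "finite (W - C)" using fin by simp
  have GW: "G \<subseteq> W" and Gd: "\<And>v x y. \<lbrakk>v \<in> G; x \<in> G; y \<in> G; E v x; E v y\<rbrakk> \<Longrightarrow> x = y"
    using G unfolding dissociation_set_iff[OF fin] by blast+
  show "dissociation_set (W - C) E (G - C)"
    unfolding dissociation_set_iff[OF finD] using GW Gd by blast
  obtain a b c d where abcd: "distinct [a, b, c, d]" "C = {a, b, c, d}" "C \<subseteq> W" "nbhd W a = {b, d}"
    "nbhd W b = {a, c}" "nbhd W c = {b, d}" "nbhd W d = {a, c}"
    using C by (rule c4_componentE)
  have "E a b" "E a d" "E b a" "E b c" "E c b" "E c d" "E d a" "E d c"
    using abcd(4-7) unfolding nbhd_def by blast+
  \<comment> \<open>Each triple of vertices of a C4 consists of one vertex and both its neighbours,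
    so no triple lies in \<open>G\<close>.\<close>
  then have no3: "\<not> (a \<in> G \<and> b \<in> G \<and> d \<in> G)" "\<not> (b \<in> G \<and> a \<in> G \<and> c \<in> G)"
    "\<not> (c \<in> G \<and> b \<in> G \<and> d \<in> G)" "\<not> (d \<in> G \<and> a \<in> G \<and> c \<in> G)"
    using Gd[of a b d] Gd[of b a c] Gd[of c b d] Gd[of d a c] abcd(1) by (simp_all; blast)+
  show "card (G \<inter> C) \<le> 2"
    by (cases "a \<in> G"; cases "b \<in> G"; cases "c \<in> G"; cases "d \<in> G")
      (use no3 in \<open>auto simp: abcd(2) card_insert_if\<close>)
qed

text \<open>The maximum sets of \<open>W\<close> are the unions of an arbitrary pair from
  \<open>C\<close> with a maximum set of \<open>W - C\<close>; the factor is 4 choose 2.\<close>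

lemma num_max_dissociation_c4:
  assumes fin: "finite W" and C: "c4_component W C"
  shows "num_max_dissociation W E = 6 * num_max_dissociation (W - C) E"
proof -
  let ?P = "{T. T \<subseteq> C \<and> card T = 2}"
  let ?M = "\<lambda>W. {F. max_dissociation_set W E F}"
  have CW: "C \<subseteq> W" and C4: "card C = 4"
    using C by (rule c4_component_subset, rule card_c4_component)
  have finC: "finite C" using CW fin by (rule finite_subset)
  have split: "card G = card (G \<inter> C) + card (G - C)" if "dissociation_set W E G" for G
  proof -
    have "finite G" using that fin by (auto simp: dissociation_set_def intro: finite_subset)
    then show ?thesis by (subst card_Un_disjoint[symmetric]) (auto intro: arg_cong[where f = card])
  qed
  have M_sub: "F \<subseteq> W - C" if "F \<in> ?M (W - C)" for F
    using that by (simp add: max_dissociation_set_def dissociation_set_def)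
  have "bij_betw (\<lambda>(T, F). T \<union> F) (?P \<times> ?M (W - C)) (?M W)"
  proof (rule bij_betw_imageI)
    show "inj_on (\<lambda>(T, F). T \<union> F) (?P \<times> ?M (W - C))"
    proof (rule inj_onI, clarsimp)
      fix T F T' F'
      assume "T \<subseteq> C" "T' \<subseteq> C" "max_dissociation_set (W - C) E F" "max_dissociation_set (W - C) E F'"
        "T \<union> F = T' \<union> F'"
      then show "T = T' \<and> F = F'" using M_sub[of F] M_sub[of F'] by blast
    qed
    show "(\<lambda>(T, F). T \<union> F) ` (?P \<times> ?M (W - C)) = ?M W"
    proof (intro equalityI subsetI)
      fix G assume "G \<in> (\<lambda>(T, F). T \<union> F) ` (?P \<times> ?M (W - C))"
      then obtain T F where G: "G = T \<union> F" and T: "T \<subseteq> C" "card T = 2"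
        and F: "max_dissociation_set (W - C) E F" by auto
      have Fd: "dissociation_set (W - C) E F"
        and Fmax: "\<And>F'. dissociation_set (W - C) E F' \<Longrightarrow> card F' \<le> card F"
        using F by (auto simp: max_dissociation_set_def)
      have "card G' \<le> card G" if G': "dissociation_set W E G'" for G'
        using split[OF G'] dissociation_c4_split(2)[OF fin C G']
          Fmax[OF dissociation_c4_split(1)[OF fin C G']] dissociation_c4_Un(2)[OF fin C T Fd, folded G]
        by linarith
      then show "G \<in> ?M W"
        using dissociation_c4_Un(1)[OF fin C T Fd] G by (simp add: max_dissociation_set_def)
    next
      fix G assume "G \<in> ?M W"
      then have Gd: "dissociation_set W E G"
        and Gmax: "\<And>G'. dissociation_set W E G' \<Longrightarrow> card G' \<le> card G"
        by (auto simp: max_dissociation_set_def)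
      note Gs = dissociation_c4_split[OF fin C Gd]
      have "2 \<le> card C" using C4 by simp
      then obtain T where T: "T \<subseteq> C" "card T = 2" by (rule obtain_subset_with_card_n)
      \<comment> \<open>Completing \<open>F\<close> by the pair \<open>T\<close> compares it with
        \<open>G\<close>. Since \<open>G\<close> has at most two vertices in \<open>C\<close>, this
        forces exactly two there and makes \<open>G - C\<close> maximum.\<close>
      have bound: "2 + card F \<le> card G" if "dissociation_set (W - C) E F" for F
        using dissociation_c4_Un[OF fin C T that] Gmax by metis
      have "card (G \<inter> C) = 2" using bound[OF Gs(1)] Gs(2) split[OF Gd] by linarith
      moreover have "card F \<le> card (G - C)" if "dissociation_set (W - C) E F" for F
        using bound[OF that] Gs(2) split[OF Gd] by linarith
      then have "max_dissociation_set (W - C) E (G - C)"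
        using Gs(1) by (simp add: max_dissociation_set_def)
      moreover have "(\<lambda>(T, F). T \<union> F) (G \<inter> C, G - C) = G" by auto
      ultimately show "G \<in> (\<lambda>(T, F). T \<union> F) ` (?P \<times> ?M (W - C))"
        by (metis (mono_tags, lifting) Int_lower2 SigmaI imageI mem_Collect_eq)
    qed
  qed
  then have "card (?P \<times> ?M (W - C)) = card (?M W)" by (rule bij_betw_same_card)
  then have "card (?M W) = card ?P * card (?M (W - C))" by (simp only: card_cartesian_product)
  also have "card ?P = 6" using n_subsets[OF finC, of 2] C4 by (simp add: choose_two)
  finally show ?thesis by (simp add: num_max_dissociation_def)
qed

lemma total_eq: "total W = decay ^ card W * real (num_max_dissociation W E)"
  by (simp add: weight_def num_max_dissociation_def)

lemma total_c4:
  assumes fin: "finite W" and C: "c4_component W C"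
  shows "total W = total (W - C)"
proof -
  show ?thesis
    by (simp add: total_eq power_add decay4 num_max_dissociation_c4[OF assms] card_c4_Diff[OF assms])
qed

section \<open>The main induction\<close>

lemma total_empty: "total {} = 1"
proof -
  have "{F. max_dissociation_set {} E F} = {{}}"
    by (auto simp: max_dissociation_set_def dissociation_set_def)
  then show ?thesis by (simp add: weight_def)
qed

text \<open>Each case assumes that the earlier ones fail: degree at most 1, degree at least 4,
  degree 3 next to degree 2, cubic, 2-regular. All give a strict inequality except a C4 component,
  whose removal preserves the total. Recording a single component suffices for equality, since the
  rest is peeled off in \<open>graph_iso_kC4_if_total\<close>.\<close>

lemma total_bound:
  assumes "finite W"
  shows "total W \<le> 1 \<and> (total W = 1 \<longrightarrow> W = {} \<or> (\<exists>C. c4_component W C))"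
  using assms
proof (induction W rule: finite_psubset_induct)
  case (psubset W)
  note fin = \<open>finite W\<close>
  have IH: "total X \<le> 1" if "X \<subset> W" for X using psubset.IH[OF that] by simp
  show ?case
  proof (cases "W = {}")
    case True
    then show ?thesis by (simp add: total_empty)
  next
    case nonempty: False
    have "total W < 1 \<or> (\<exists>C. c4_component W C)"
    proof (cases "\<exists>u\<in>W. card (nbhd W u) \<le> 1")
      case True
      then obtain u where "u \<in> W" "card (nbhd W u) \<le> 1" by blast
      then have "total W \<le> 8358 / 10000" using IH by (rule total_leaf_le[OF fin])
      then show ?thesis by linarith
    next
      case False
      then have min2: "2 \<le> card (nbhd W u)" if "u \<in> W" for u using that by force
      then have deg2: "2 \<le> card (nbhd W u)" if "u \<in> nbhd W v" for u v
        using that nbhd_subset by blast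
      show ?thesis
      proof (cases "\<exists>v\<in>W. 4 \<le> card (nbhd W v)")
        case True
        then obtain v where "v \<in> W" "4 \<le> card (nbhd W v)" by blast
        then have "total W < 1" using deg2 IH by (rule total_degree_ge_4[OF fin])
        then show ?thesis by blast
      next
        case False
        then have max3: "card (nbhd W u) \<le> 3" if "u \<in> W" for u using that by force
        have deg: "card (nbhd W u) = 2 \<or> card (nbhd W u) = 3" if "u \<in> W" for u
          using min2[OF that] max3[OF that] by linarith
        show ?thesis
        proof (cases "\<exists>v\<in>W. card (nbhd W v) = 3 \<and> (\<exists>u\<in>nbhd W v. card (nbhd W u) = 2)")
          case True
          then obtain v u where vu: "v \<in> W" "card (nbhd W v) = 3" "u \<in> nbhd W v" "card (nbhd W u) = 2"
            by blast
          have "total W \<le> 99 / 100"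
            using fin vu(1,2) deg2 vu(3,4) IH by (rule total_degree_3(1))
          then show ?thesis by linarith
        next
          case no_mixed: False
          show ?thesis
          proof (cases "\<exists>v\<in>W. card (nbhd W v) = 3")
            case True
            then obtain v where v: "v \<in> W" "card (nbhd W v) = 3" by blast
            have "total W < 1"
            proof (rule total_cubic[OF fin v _ IH])
              fix a b assume "a \<in> W" "card (nbhd W a) = 3" "b \<in> nbhd W a"
              then show "card (nbhd W b) = 3" using no_mixed deg nbhd_subset by blast
            qed
            then show ?thesis by blast
          next
            case False
            then have regular: "card (nbhd W u) = 2" if "u \<in> W" for u using deg that by blast
            obtain v where "v \<in> W" using nonempty by blast
            then show ?thesis using regular IH by (rule total_2_regular[OF fin])
          qed
        qed
      qed
    qed
    then show ?thesis
    proof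
      assume "\<exists>C. c4_component W C"
      then obtain C where C: "c4_component W C" by blast
      then have "W - C \<subset> W" by (rule c4_component_Diff)
      then have "total (W - C) \<le> 1" by (rule IH)
      then show ?thesis using total_c4[OF fin C] C by metis
    qed simp
  qed
qed

section \<open>Isomorphism with disjoint copies of C4\<close>

lemma graph_iso_c4_extend:
  assumes C: "c4_component W C" and iso: "graph_iso (W - C) E (kC4_verts k) (kC4_edge k)"
  shows "graph_iso W E (kC4_verts (Suc k)) (kC4_edge (Suc k))"
proof -
  obtain a b c d where dist: "distinct [a, b, c, d]" and Cd: "C = {a, b, c, d}" and CW: "C \<subseteq> W"
    and nb: "nbhd W a = {b, d}" "nbhd W b = {a, c}" "nbhd W c = {b, d}" "nbhd W d = {a, c}"
    using C by (rule c4_componentE)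
  obtain f where f: "bij_betw f (W - C) (kC4_verts k)"
    and fE: "\<And>x y. \<lbrakk>x \<in> W - C; y \<in> W - C\<rbrakk> \<Longrightarrow> E x y \<longleftrightarrow> kC4_edge k (f x) (f y)"
    using iso unfolding graph_iso_def by blast
  \<comment> \<open>The cycle goes in its cyclic order onto the new copy with index
    \<open>k\<close>; elsewhere \<open>f\<close> is kept.\<close>
  define g where "g x = (if x = a then (k, 0) else if x = b then (k, 1) else if x = c then (k, 2)
    else if x = d then (k, 3) else f x)" for x
  have gC: "g a = (k, 0)" "g b = (k, 1)" "g c = (k, 2)" "g d = (k, 3)"
    using dist by (auto simp: g_def)
  have gD: "g x = f x" if "x \<in> W - C" for x using that by (auto simp: g_def Cd)
  have fV: "f x \<in> kC4_verts k" if "x \<in> W - C" for x using f that by (rule bij_betwE[rule_format])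
  have "bij_betw g C {(k, 0), (k, 1), (k, 2), (k, 3)}"
    unfolding bij_betw_def Cd using gC dist by (auto simp: inj_on_def)
  moreover have "bij_betw g (W - C) (kC4_verts k)"
    using f gD by (metis (no_types, lifting) bij_betw_cong)
  moreover have "{(k, 0), (k, 1), (k, 2), (k, 3)} \<inter> kC4_verts k = {}"
    by (auto simp: kC4_verts_def)
  ultimately have "bij_betw g (C \<union> (W - C)) (kC4_verts (Suc k))"
    unfolding kC4_verts_Suc by (rule bij_betw_combine)
  moreover have "C \<union> (W - C) = W" using CW by blast
  ultimately have bij: "bij_betw g W (kC4_verts (Suc k))" by simp
  then have inj: "g x = g y \<longleftrightarrow> x = y" if "x \<in> W" "y \<in> W" for x y
    using that by (auto simp: bij_betw_def inj_on_def)
  \<comment> \<open>At a vertex of \<open>C\<close> both neighbourhoods are explicit lists, compared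
    through the injectivity of \<open>g\<close>. Edges whose other end lies in \<open>C\<close>
    follow by symmetry.\<close>
  have edge_C: "E x y \<longleftrightarrow> kC4_edge (Suc k) (g x) (g y)" if "x \<in> C" "y \<in> W" for x y
  proof -
    have "a \<in> W" "b \<in> W" "c \<in> W" "d \<in> W" using CW Cd by auto
    then have y: "y = a \<longleftrightarrow> g y = (k, 0)" "y = b \<longleftrightarrow> g y = (k, Suc 0)"
      "y = c \<longleftrightarrow> g y = (k, 2)" "y = d \<longleftrightarrow> g y = (k, 3)"
      using inj[OF that(2)] gC by (metis One_nat_def)+
    have "E x y \<longleftrightarrow> y \<in> nbhd W x" using that(2) by (simp add: nbhd_def)
    also have "\<dots> \<longleftrightarrow> kC4_edge (Suc k) (g x) (g y)"
      using that(1) unfolding Cd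
      by (elim insertE emptyE) (simp_all add: nb gC kC4_edge_top y)
    finally show ?thesis .
  qed
  have "E x y \<longleftrightarrow> kC4_edge (Suc k) (g x) (g y)" if xy: "x \<in> W" "y \<in> W" for x y
  proof -
    consider "x \<in> C" | "y \<in> C" | "x \<in> W - C" "y \<in> W - C" using xy by blast
    then show ?thesis
    proof cases
      case 1
      then show ?thesis using edge_C xy by blast
    next
      case 2
      then show ?thesis using edge_C[OF 2 xy(1)] sym kC4_edge_sym by blast
    next
      case 3
      then show ?thesis using fE gD fV by (simp add: kC4_edge_Suc)
    qed
  qed
  then show ?thesis unfolding graph_iso_def using bij by blast
qed

text \<open>Neighbourhoods pull back along the bijection, so the preimage of the copy with index
  \<open>k\<close> is a 4-cycle component, and \<open>f\<close> restricted to the rest reaches the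
  other copies.\<close>

lemma graph_iso_c4_remove:
  assumes "graph_iso W E (kC4_verts (Suc k)) (kC4_edge (Suc k))"
  shows "\<exists>C. c4_component W C \<and> graph_iso (W - C) E (kC4_verts k) (kC4_edge k)"
proof -
  obtain f where f: "bij_betw f W (kC4_verts (Suc k))"
    and fE: "\<And>x y. \<lbrakk>x \<in> W; y \<in> W\<rbrakk> \<Longrightarrow> E x y \<longleftrightarrow> kC4_edge (Suc k) (f x) (f y)"
    using assms unfolding graph_iso_def by blast
  have inj: "inj_on f W" and img: "f ` W = kC4_verts (Suc k)" using f by (auto simp: bij_betw_def)
  have "\<exists>x\<in>W. f x = p" if "p \<in> {(k, 0), (k, 1), (k, 2), (k, 3)}" for p
    using that img kC4_verts_Suc[of k] by (metis UnI1 imageE)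
  then obtain a b c d where abcd: "a \<in> W" "b \<in> W" "c \<in> W" "d \<in> W"
    "f a = (k, 0)" "f b = (k, 1)" "f c = (k, 2)" "f d = (k, 3)"
    by (metis insertCI)
  let ?C = "{a, b, c, d}"
  have eq: "f u = f x \<longleftrightarrow> u = x" if "u \<in> W" "x \<in> W" for u x
    using inj that by (auto simp: inj_on_def)
  have nb: "nbhd W x = {u\<in>W. kC4_edge (Suc k) (f x) (f u)}" if "x \<in> W" for x
    using that fE by (auto simp: nbhd_def)
  have pair: "{u\<in>W. f u = f x \<or> f u = f y} = {x, y}" if "x \<in> W" "y \<in> W" for x y
    using that eq by auto
  have "nbhd W a = {b, d}" "nbhd W b = {a, c}" "nbhd W c = {b, d}" "nbhd W d = {a, c}"
    using abcd pair[of a c] pair[of b d] by (simp_all add: nb kC4_edge_top)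
  moreover have "distinct [a, b, c, d]" using abcd by auto
  ultimately have C: "c4_component W ?C"
    unfolding c4_component_def using abcd(1-4)
    by - (rule exI[of _ a], rule exI[of _ b], rule exI[of _ c], rule exI[of _ d], simp)
  have "f ` (W - ?C) = f ` W - f ` ?C"
    using inj abcd by (intro inj_on_image_set_diff) auto
  also have "\<dots> = kC4_verts k"
    using img abcd fst_kC4_verts[of _ k] by (force simp: kC4_verts_Suc)
  finally have bij: "bij_betw f (W - ?C) (kC4_verts k)"
    using inj by (auto simp: bij_betw_def intro: inj_on_subset)
  moreover have "E x y \<longleftrightarrow> kC4_edge k (f x) (f y)" if "x \<in> W - ?C" "y \<in> W - ?C" for x y
    using that fE[of x y] bij_betwE[OF bij] by (auto simp: kC4_edge_Suc)
  ultimately have "graph_iso (W - ?C) E (kC4_verts k) (kC4_edge k)"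
    unfolding graph_iso_def by blast
  then show ?thesis using C by blast
qed

text \<open>Each removed 4-cycle leaves the total unchanged, down to the empty graph with total
  1.\<close>

lemma total_kC4:
  "finite W \<Longrightarrow> graph_iso W E (kC4_verts k) (kC4_edge k) \<Longrightarrow> total W = 1"
proof (induction k arbitrary: W)
  case 0
  then have "W = {}" by (auto simp: graph_iso_def kC4_verts_def bij_betw_def)
  then show ?case by (simp add: total_empty)
next
  case (Suc k)
  obtain C where C: "c4_component W C" "graph_iso (W - C) E (kC4_verts k) (kC4_edge k)"
    using graph_iso_c4_remove[OF Suc.prems(2)] by blast
  then show ?case using Suc.IH[of "W - C"] Suc.prems(1) total_c4[OF Suc.prems(1) C(1)] by simp
qed

text \<open>Total 1 on a nonempty set yields a C4 component by \<open>total_bound\<close>, and its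
  removal keeps the total at 1. The descent ends at the empty set, and \<open>k\<close> counts the
  removals.\<close>

lemma graph_iso_kC4_if_total:
  "finite W \<Longrightarrow> total W = 1 \<Longrightarrow> \<exists>k. card W = 4 * k \<and> graph_iso W E (kC4_verts k) (kC4_edge k)"
proof (induction W rule: finite_psubset_induct)
  case (psubset W)
  show ?case
  proof (cases "W = {}")
    case True
    then show ?thesis
      by (auto simp: graph_iso_def kC4_verts_def bij_betw_def)
  next
    case False
    then obtain C where C: "c4_component W C"
      using total_bound[OF psubset.hyps] psubset.prems by metis
    have "total (W - C) = 1" using psubset.prems total_c4[OF psubset.hyps C] by simp
    then obtain k where k: "card (W - C) = 4 * k" "graph_iso (W - C) E (kC4_verts k) (kC4_edge k)"
      using psubset.IH[OF c4_component_Diff[OF C]] by blast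
    have "card W = 4 * Suc k" using k(1) card_c4_Diff[OF psubset.hyps C] by simp
    then show ?thesis using graph_iso_c4_extend[OF C k(2)] by blast
  qed
qed

end

section \<open>Translation back to 6^(n/4)\<close>

lemma decay_powr: "decay ^ n * 6 powr (real n / 4) = 1"
proof -
  have "root 4 6 ^ n = 6 powr (real n / 4)"
    by (simp add: root_powr_inverse powr_power)
  then show ?thesis by (simp add: decay_def power_one_over)
qed

theorem theorem1p4:
  fixes V :: "'a set" and E :: "'a \<Rightarrow> 'a \<Rightarrow> bool" and n :: nat
  assumes "simple_graph V E" and "triangle_free V E" and "card V = n"
  shows "real (num_max_dissociation V E) \<le> 6 powr (real n / 4) \<and>
         (real (num_max_dissociation V E) = 6 powr (real n / 4) \<longleftrightarrow>
           (n mod 4 = 0 \<and> graph_iso V E (kC4_verts (n div 4)) (kC4_edge (n div 4))))"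
proof -
  have fin: "finite V" using assms(1) by (simp add: simple_graph_def)
  interpret triangle_free_graph E
  proof
    show "E x y \<Longrightarrow> E y x" "\<not> E x x" for x y using assms(1) by (auto simp: simple_graph_def)
    show "\<not> E x z" if "E x y" "E y z" for x y z
      using assms(1,2) that unfolding simple_graph_def triangle_free_def by metis
  qed
  let ?N = "real (num_max_dissociation V E)"
  have total: "total V = decay ^ n * ?N" using assms(3) by (simp add: total_eq)
  have pos: "decay ^ n > 0" using decay_pos by simp
  \<comment> \<open>Multiplying by the positive number \<open>decay ^ n\<close> turns the bound
    \<open>6 powr (n / 4)\<close> into 1, for the inequality and for equality alike.\<close>
  have le: "?N \<le> 6 powr (real n / 4) \<longleftrightarrow> total V \<le> 1"
    unfolding total decay_powr[of n, symmetric] using pos by simp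
  have eq: "?N = 6 powr (real n / 4) \<longleftrightarrow> total V = 1"
    unfolding total decay_powr[of n, symmetric] using decay_pos by simp
  have "total V = 1 \<longleftrightarrow> n mod 4 = 0 \<and> graph_iso V E (kC4_verts (n div 4)) (kC4_edge (n div 4))"
  proof
    assume "total V = 1"
    then obtain k where "n = 4 * k" "graph_iso V E (kC4_verts k) (kC4_edge k)"
      using graph_iso_kC4_if_total[OF fin] assms(3) by metis
    then show "n mod 4 = 0 \<and> graph_iso V E (kC4_verts (n div 4)) (kC4_edge (n div 4))" by simp
  qed (use total_kC4[OF fin] in blast)
  moreover have "total V \<le> 1" using total_bound[OF fin] by (rule conjunct1)
  ultimately show ?thesis using le eq by simp
qed

end
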